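(* Let $h>0$, $\mathcal H=L^2(0,1)$, $\mathcal U=\{u_j(x)=h^xe^{2\pi i xj}\}_{j\in\mathbb Z}$ and $\Lambda=\{\lambda_j=-i\ln h+2j\pi\}_{j\in\mathbb Z}$. Then the operator $\mathcal L:L^2(0,1)\to L^2(0,1)$ associated to the pair $(\mathcal U,\Lambda)$ coincides with $\mathrm O_h^{(1)}$, the operator $-i\frac{d}{dx}$ on $(0,1)$ with the boundary condition $h\,y(0)=y(1)$. The corresponding $\mathcal U$-convolution can be written in the integral form $$(f\star_{\mathcal U}g)(x)=\int_0^x f(x-t)g(t)\,dt+\frac1h\int_x^1 f(1+x-t)g(t)\,dt .$$
   Context: The inner product on $L^2(0,1)$ is $(f,g)=\int_0^1 f\overline g\,dx$. The system $\mathcal U$ is a Riesz basis of $L^2(0,1)$, with biorthogonal system $\mathcal V=\{v_j(x)=h^{-x}e^{2\pi i xj}\}_{j\in\mathbb Z}$, $(u_j,v_k)=\delta_{jk}$. The operator associated to the pair $(\mathcal U,\Lambda)$ is $\mathcal Lf:=\sum_{j\in\mathbb Z}\lambda_j(f,v_j)u_j$, with domain consisting of those $f\in L^2(0,1)$ for which the series converges in $L^2(0,1)$. $\mathrm O_h^{(1)}$ acts as $y\mapsto -i\,y'$ on the domain $\{y\in W^{1,2}(0,1): h\,y(0)=y(1)\}$. The $\mathcal U$-convolution of $f,g\in L^2(0,1)$ is $f\star_{\mathcal U}g:=\sum_{j\in\mathbb Z}(f,v_j)(g,v_j)u_j$ (convergent in $L^2(0,1)$); the integral formula holds for $f,g\in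 L^2(0,1)$ and almost every $x\in(0,1)$. *)

theory Defs
  imports "HOL-Analysis.Analysis"
begin

text \<open>
  Elements of \<open>L\<^sup>2(0,1)\<close> are represented by complex functions on the reals of which only the values
  on \<open>(0,1)\<close> matter; representatives that agree almost everywhere on \<open>(0,1)\<close> denote the same
  element. All predicates and domains below are invariant under such a change of representative,
  and the operators are determined by them up to null sets.
\<close>

abbreviation I01 :: "real measure" where
  "I01 \<equiv> lebesgue_on {0<..<1}"

definition L2 :: "(real \<Rightarrow> complex) set" where
  "L2 = {f. f \<in> borel_measurable I01 \<and> integrable I01 (\<lambda>x. (cmod (f x))\<^sup>2)}"

definition L2_inner :: "(real \<Rightarrow> complex) \<Rightarrow> (real \<Rightarrow> complex) \<Rightarrow> complex" where
  "L2_inner f g = (LINT x|I01. f x * cnj (g x))"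

definition L2_norm :: "(real \<Rightarrow> complex) \<Rightarrow> real" where
  "L2_norm f = sqrt (LINT x|I01. (cmod (f x))\<^sup>2)"

text \<open>
  A series over the integers converges in \<open>L\<^sup>2(0,1)\<close> if the net of its finite partial sums does.
  The series used here are expansions in a Riesz basis; for these, this is equivalent to convergence
  of the symmetric partial sums over \<open>{-n..n}\<close>.
\<close>

definition L2_has_sum :: "(int \<Rightarrow> real \<Rightarrow> complex) \<Rightarrow> (real \<Rightarrow> complex) \<Rightarrow> bool" where
  "L2_has_sum a s \<longleftrightarrow> (\<forall>j. a j \<in> L2) \<and> s \<in> L2 \<and>
     ((\<lambda>F. L2_norm (\<lambda>x. (\<Sum>j\<in>F. a j x) - s x)) \<longlongrightarrow> 0) (finite_subsets_at_top UNIV)"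

definition L2_summable :: "(int \<Rightarrow> real \<Rightarrow> complex) \<Rightarrow> bool" where
  "L2_summable a \<longleftrightarrow> (\<exists>s. L2_has_sum a s)"

definition L2_sum :: "(int \<Rightarrow> real \<Rightarrow> complex) \<Rightarrow> real \<Rightarrow> complex" where
  "L2_sum a = (SOME s. L2_has_sum a s)"

text \<open>
  In \<open>assoc_series\<close> to \<open>U_conv\<close> below, \<open>U\<close> is a Riesz basis of \<open>L\<^sup>2(0,1)\<close> and \<open>V\<close> its biorthogonal system.
\<close>

definition assoc_series ::
  "(int \<Rightarrow> real \<Rightarrow> complex) \<Rightarrow> (int \<Rightarrow> real \<Rightarrow> complex) \<Rightarrow> (int \<Rightarrow> complex) \<Rightarrow>
   (real \<Rightarrow> complex) \<Rightarrow> int \<Rightarrow> real \<Rightarrow> complex" where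
  "assoc_series U V \<Lambda> f = (\<lambda>j x. \<Lambda> j * L2_inner f (V j) * U j x)"

definition assoc_dom ::
  "(int \<Rightarrow> real \<Rightarrow> complex) \<Rightarrow> (int \<Rightarrow> real \<Rightarrow> complex) \<Rightarrow> (int \<Rightarrow> complex) \<Rightarrow>
   (real \<Rightarrow> complex) set" where
  "assoc_dom U V \<Lambda> = {f \<in> L2. L2_summable (assoc_series U V \<Lambda> f)}"

definition assoc_op ::
  "(int \<Rightarrow> real \<Rightarrow> complex) \<Rightarrow> (int \<Rightarrow> real \<Rightarrow> complex) \<Rightarrow> (int \<Rightarrow> complex) \<Rightarrow>
   (real \<Rightarrow> complex) \<Rightarrow> real \<Rightarrow> complex" where
  "assoc_op U V \<Lambda> f = L2_sum (assoc_series U V \<Lambda> f)"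

definition conv_series ::
  "(int \<Rightarrow> real \<Rightarrow> complex) \<Rightarrow> (int \<Rightarrow> real \<Rightarrow> complex) \<Rightarrow>
   (real \<Rightarrow> complex) \<Rightarrow> (real \<Rightarrow> complex) \<Rightarrow> int \<Rightarrow> real \<Rightarrow> complex" where
  "conv_series U V f g = (\<lambda>j x. L2_inner f (V j) * L2_inner g (V j) * U j x)"

definition U_conv ::
  "(int \<Rightarrow> real \<Rightarrow> complex) \<Rightarrow> (int \<Rightarrow> real \<Rightarrow> complex) \<Rightarrow>
   (real \<Rightarrow> complex) \<Rightarrow> (real \<Rightarrow> complex) \<Rightarrow> real \<Rightarrow> complex" where
  "U_conv U V f g = L2_sum (conv_series U V f g)"

definition u_sys :: "real \<Rightarrow> int \<Rightarrow> real \<Rightarrow> complex" where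
  "u_sys h j x = of_real (h powr x) * exp (2 * of_real pi * \<i> * of_real x * of_int j)"

definition v_sys :: "real \<Rightarrow> int \<Rightarrow> real \<Rightarrow> complex" where
  "v_sys h j x = of_real (h powr (- x)) * exp (2 * of_real pi * \<i> * of_real x * of_int j)"

definition lambda_sys :: "real \<Rightarrow> int \<Rightarrow> complex" where
  "lambda_sys h j = - \<i> * of_real (ln h) + 2 * of_int j * of_real pi"

text \<open>
  \<open>C\<^sub>c\<^sup>\<infinity>(0,1)\<close>, the functions being extended by zero to the real line. The support is bounded, hence
  compact.
\<close>

definition test_fun :: "(real \<Rightarrow> real) \<Rightarrow> bool" where
  "test_fun \<phi> \<longleftrightarrow> (\<forall>n x. (deriv ^^ n) \<phi> field_differentiable at x) \<and>
     closure {x. \<phi> x \<noteq> 0} \<subseteq> {0<..<1}"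

definition has_weak_deriv :: "(real \<Rightarrow> complex) \<Rightarrow> (real \<Rightarrow> complex) \<Rightarrow> bool" where
  "has_weak_deriv y g \<longleftrightarrow> (\<forall>\<phi>. test_fun \<phi> \<longrightarrow>
     (LINT x|I01. y x * of_real (deriv \<phi> x)) = - (LINT x|I01. g x * of_real (\<phi> x)))"

definition W12 :: "(real \<Rightarrow> complex) set" where
  "W12 = {y \<in> L2. \<exists>g \<in> L2. has_weak_deriv y g}"

definition weak_deriv :: "(real \<Rightarrow> complex) \<Rightarrow> real \<Rightarrow> complex" where
  "weak_deriv y = (SOME g. g \<in> L2 \<and> has_weak_deriv y g)"

text \<open>
  The boundary values of \<open>y \<in> W\<^sup>1\<^sup>,\<^sup>2(0,1)\<close> are those of its (unique) representative that is
  continuous on \<open>[0,1]\<close>, not the values of the function \<open>y\<close> itself at \<open>0\<close> and \<open>1\<close>.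
\<close>

definition O_dom :: "real \<Rightarrow> (real \<Rightarrow> complex) set" where
  "O_dom h = {y \<in> W12. \<exists>Y. continuous_on {0..1} Y \<and> (AE x in I01. Y x = y x) \<and>
     of_real h * Y 0 = Y 1}"

definition O_op :: "(real \<Rightarrow> complex) \<Rightarrow> real \<Rightarrow> complex" where
  "O_op y = (\<lambda>x. - \<i> * weak_deriv y x)"

end

theory Submission
  imports Defs
begin

text \<open>
  Multiplication by \<open>h\<^sup>x\<close> carries the Fourier basis to \<open>u\<close>, so the expansion
  \<open>f = \<Sum>\<^sub>j (f, v\<^sub>j) u\<^sub>j\<close> reduces to the density of trigonometric polynomials, which
  Stone-Weierstrass on the unit circle gives. By density, integration by parts holds for primitives of
  \<open>L\<^sup>2\<close> functions. As the conjugate of \<open>v\<^sub>j\<close> is \<open>e\<^bsup>-i \<lambda>\<^sub>j x\<^esup>\<close>, a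
  primitive \<open>Y\<close> of \<open>g\<close> satisfies \<open>(g, v\<^sub>j) = i \<lambda>\<^sub>j (Y, v\<^sub>j) + (Y(1)/h - Y(0))\<close>,
  and the boundary condition is precisely the vanishing of the last term. For the convolution, the integral
  formula is bounded by a multiple of the product of the norms at every point, and for \<open>f = u\<^sub>j\<close> it
  equals \<open>(g, v\<^sub>j) u\<^sub>j\<close>; expanding \<open>f\<close>, the partial sums converge uniformly.
\<close>

subsection \<open>Square-integrable functions\<close>

text \<open>The obstacle is that \<open>W12\<close> is defined through test functions, while the
  boundary condition speaks of values at the endpoints. The bridge is
  \<open>has_weak_deriv_iff_primitive\<close>. One half of it is integration by parts; the other is
  the du Bois-Reymond lemma, for which smooth functions with support inside the interval must be
  built, whence \<open>flat_exp\<close>, \<open>flat_alg\<close> and \<open>plateau\<close>. That an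
  almost everywhere vanishing integrand is recovered from a vanishing primitive comes from
  completeness of the Fourier system instead of Lebesgue differentiation.

  The boundary term in the coefficient identity is the same for every j, because the conjugate of
  v_j equals 1 at 0 and 1/h at 1 whatever j is. So, given a function whose series converges, the
  free constant of integration can be spent on matching the coefficients at j = 0; this forces the
  boundary term to vanish, also for h = 1, where lambda_0 = 0.

  The pointwise bound on the convolution integral also gives its measurability, as a pointwise limit
  of partial sums, in place of a Fubini argument.\<close>

lemma integral_mult_sq_bound:
  fixes f g :: "'a \<Rightarrow> complex"
  assumes f: "f \<in> borel_measurable M" "integrable M (\<lambda>x. (cmod (f x))\<^sup>2)"
    and g: "g \<in> borel_measurable M" "integrable M (\<lambda>x. (cmod (g x))\<^sup>2)"
  shows integrable_mult_sq: "integrable M (\<lambda>x. f x * g x)"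
    and Cauchy_Schwarz_integral: "cmod (LINT x|M. f x * g x) \<le>
      sqrt (LINT x|M. (cmod (f x))\<^sup>2) * sqrt (LINT x|M. (cmod (g x))\<^sup>2)"
proof -
  have weighted: "2 * s * t * (a * b) \<le> s\<^sup>2 * a\<^sup>2 + t\<^sup>2 * b\<^sup>2" for s t a b :: real
    using zero_le_power2 [of "s * a - t * b"] by (simp add: power2_diff power_mult_distrib algebra_simps)
  have "cmod (f x * g x) \<le> norm ((cmod (f x))\<^sup>2 + (cmod (g x))\<^sup>2)" for x
  proof -
    have "0 \<le> cmod (f x) * cmod (g x)" by simp
    then have "cmod (f x * g x) \<le> (cmod (f x))\<^sup>2 + (cmod (g x))\<^sup>2"
      using weighted[of 1 1 "cmod (f x)" "cmod (g x)"] unfolding norm_mult power_one mult_1_left mult_1_right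
      by linarith
    then show ?thesis by simp
  qed
  then show int: "integrable M (\<lambda>x. f x * g x)"
    using f g by (intro Bochner_Integration.integrable_bound[OF Bochner_Integration.integrable_add[OF f(2) g(2)]]) auto
  define A where "A = (LINT x|M. (cmod (f x))\<^sup>2)"
  define B where "B = (LINT x|M. (cmod (g x))\<^sup>2)"
  define C where "C = (LINT x|M. cmod (f x) * cmod (g x))"
  have nonneg: "A \<ge> 0" "B \<ge> 0" unfolding A_def B_def by auto
  \<comment> \<open>The weights stay free here and are chosen afterwards. The measure
    \<open>M\<close> is arbitrary because the convolution applies the result on
    subintervals.\<close>
  have key: "2 * s * t * C \<le> s\<^sup>2 * A + t\<^sup>2 * B" for s t
  proof -
    have "2 * s * t * C = (LINT x|M. 2 * s * t * (cmod (f x) * cmod (g x)))"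
      unfolding C_def by simp
    also have "\<dots> \<le> (LINT x|M. s\<^sup>2 * (cmod (f x))\<^sup>2 + t\<^sup>2 * (cmod (g x))\<^sup>2)"
    proof (rule integral_mono)
      show "integrable M (\<lambda>x. 2 * s * t * (cmod (f x) * cmod (g x)))"
        using integrable_norm[OF int] by (simp add: norm_mult)
    qed (use f g weighted in auto)
    also have "\<dots> = s\<^sup>2 * A + t\<^sup>2 * B"
      unfolding A_def B_def using f g by simp
    finally show ?thesis .
  qed
  have "C \<le> sqrt A * sqrt B"
  proof (rule field_le_epsilon)
    fix e :: real assume "e > 0"
    show "C \<le> sqrt A * sqrt B + e"
    proof (cases "A = 0 \<or> B = 0")
      case True
      \<comment> \<open>If \<open>A\<close> or \<open>B\<close> is zero, the weight on that side can
        be enlarged at no cost: the choices below would give \<open>2 * (B + 1) \<le> B\<close> or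
        \<open>2 * (A + 1) \<le> A\<close>.\<close>
      have "C \<le> 0"
      proof (rule ccontr)
        assume "\<not> C \<le> 0"
        with True key[of "(B + 1) / C" 1] key[of 1 "(A + 1) / C"] nonneg show False
          by auto
      qed
      then show ?thesis using True \<open>e > 0\<close> by auto
    next
      case False
      with nonneg have "sqrt A * sqrt B > 0" by auto
      \<comment> \<open>The optimal weights \<open>s = sqrt B\<close> and \<open>t = sqrt A\<close>
        make both squares equal to \<open>A * B\<close>.\<close>
      moreover have "(sqrt A * sqrt B) * C \<le> (sqrt A * sqrt B) * (sqrt A * sqrt B)"
        using key[of "sqrt B" "sqrt A"] nonneg by (simp add: algebra_simps)
      ultimately have "C \<le> sqrt A * sqrt B" by (simp only: mult_le_cancel_left_pos)
      then show ?thesis using \<open>e > 0\<close> by simp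
    qed
  qed
  moreover have "cmod (LINT x|M. f x * g x) \<le> C"
    unfolding C_def norm_mult[symmetric] by (rule integral_norm_bound)
  ultimately show "cmod (LINT x|M. f x * g x) \<le>
      sqrt (LINT x|M. (cmod (f x))\<^sup>2) * sqrt (LINT x|M. (cmod (g x))\<^sup>2)"
    unfolding A_def B_def by linarith
qed

lemma finite_measure_I01: "finite_measure I01"
  by (rule finite_measure_lebesgue_on) simp

lemma measure_I01: "measure I01 (space I01) = 1"
  by (simp add: measure_restrict_space)

lemma L2_measurable: "f \<in> L2 \<Longrightarrow> f \<in> borel_measurable I01"
  by (simp add: L2_def)

lemma L2_sq_integrable: "f \<in> L2 \<Longrightarrow> integrable I01 (\<lambda>x. (cmod (f x))\<^sup>2)"
  by (simp add: L2_def)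

lemma L2_bounded:
  assumes "f \<in> borel_measurable I01" "\<And>x. x \<in> {0<..<1} \<Longrightarrow> cmod (f x) \<le> B"
  shows "f \<in> L2" "L2_norm f \<le> B"
proof -
  interpret finite_measure I01 by (rule finite_measure_I01)
  have bd: "(cmod (f x))\<^sup>2 \<le> B\<^sup>2" if "x \<in> {0<..<1}" for x
    using assms(2)[OF that] by (intro power_mono) auto
  show *: "f \<in> L2" unfolding L2_def
    using assms bd by (auto intro!: integrable_const_bound[where B="B\<^sup>2"])
  have "B \<ge> 0" using assms(2)[of "1/2"] norm_ge_zero[of "f (1/2)"] by (smt (verit) greaterThanLessThan_iff field_sum_of_halves)
  have "(LINT x|I01. (cmod (f x))\<^sup>2) \<le> (LINT x|I01. B\<^sup>2)"
    using L2_sq_integrable[OF *] bd by (intro integral_mono) auto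
  then show "L2_norm f \<le> B"
    unfolding L2_norm_def using \<open>B \<ge> 0\<close> measure_I01
    by (intro real_le_lsqrt) (simp_all del: space_restrict_space)
qed

lemma L2_continuous:
  assumes "continuous_on {0..1} f"
  shows "f \<in> L2"
proof -
  have "bounded (f ` {0..1})"
    using assms by (intro compact_imp_bounded compact_continuous_image) auto
  then obtain B where B: "\<forall>x\<in>{0..1}. cmod (f x) \<le> B"
    by (auto simp: bounded_iff)
  have "f \<in> borel_measurable I01"
    using assms by (intro continuous_imp_measurable_on_sets_lebesgue) (auto intro: continuous_on_subset)
  then show ?thesis using B by (intro L2_bounded(1)[of f B]) auto
qed

lemma L2_mult_integrable: "f \<in> L2 \<Longrightarrow> g \<in> L2 \<Longrightarrow> integrable I01 (\<lambda>x. f x * g x)"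
  by (rule integrable_mult_sq; erule L2_measurable L2_sq_integrable)

lemma L2_Cauchy_Schwarz: "f \<in> L2 \<Longrightarrow> g \<in> L2 \<Longrightarrow> cmod (LINT x|I01. f x * g x) \<le> L2_norm f * L2_norm g"
  unfolding L2_norm_def by (rule Cauchy_Schwarz_integral; erule L2_measurable L2_sq_integrable)

lemma L2_cnj: "f \<in> L2 \<Longrightarrow> (\<lambda>x. cnj (f x)) \<in> L2"
  unfolding L2_def by (auto simp: borel_measurable_complex_iff)

lemma L2_norm_cnj: "L2_norm (\<lambda>x. cnj (f x)) = L2_norm f"
  unfolding L2_norm_def by simp

lemma L2_const: "(\<lambda>x. c) \<in> L2"
  by (rule L2_bounded(1)[of _ "cmod c"]) auto

lemma L2_integrable: "f \<in> L2 \<Longrightarrow> integrable I01 f"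
  using L2_mult_integrable[of f "\<lambda>x. 1"] L2_const by simp

lemma L2_norm_nonneg [simp]: "L2_norm f \<ge> 0"
  by (simp add: L2_norm_def)

lemma L2_norm_sq: "(L2_norm f)\<^sup>2 = (LINT x|I01. (cmod (f x))\<^sup>2)"
  unfolding L2_norm_def by simp

lemma L2_add: assumes "f \<in> L2" "g \<in> L2" shows "(\<lambda>x. f x + g x) \<in> L2"
proof -
  have "(cmod (f x + g x))\<^sup>2 \<le> 2 * (cmod (f x))\<^sup>2 + 2 * (cmod (g x))\<^sup>2" for x
  proof -
    have "(cmod (f x + g x))\<^sup>2 \<le> (cmod (f x) + cmod (g x))\<^sup>2"
      by (intro power_mono norm_triangle_ineq) auto
    then show ?thesis
      using zero_le_power2[of "cmod (f x) - cmod (g x)"]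
      by (simp add: power2_diff power2_sum)
  qed
  then have le: "norm ((cmod (f x + g x))\<^sup>2) \<le> norm (2 * (cmod (f x))\<^sup>2 + 2 * (cmod (g x))\<^sup>2)" for x
    by simp
  have "integrable I01 (\<lambda>x. (cmod (f x + g x))\<^sup>2)"
    by (rule Bochner_Integration.integrable_bound[OF _ _ AE_I2[OF le]])
      (use assms in \<open>auto simp: L2_def\<close>)
  then show ?thesis using assms by (auto simp: L2_def)
qed

lemma L2_mult_bounded:
  assumes "f \<in> L2" "k \<in> borel_measurable I01" "\<And>x. x \<in> {0<..<1} \<Longrightarrow> cmod (k x) \<le> B"
  shows "(\<lambda>x. k x * f x) \<in> L2" "L2_norm (\<lambda>x. k x * f x) \<le> B * L2_norm f"
proof -
  have "B \<ge> 0" using assms(3)[of "1/2"] norm_ge_zero[of "k (1/2)"] by (smt (verit) greaterThanLessThan_iff field_sum_of_halves)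
  have bd: "(cmod (k x * f x))\<^sup>2 \<le> B\<^sup>2 * (cmod (f x))\<^sup>2" if "x \<in> {0<..<1}" for x
    using assms(3)[OF that] by (auto simp: norm_mult power_mult_distrib intro!: mult_right_mono power_mono)
  have int: "integrable I01 (\<lambda>x. B\<^sup>2 * (cmod (f x))\<^sup>2)"
    using L2_sq_integrable[OF assms(1)] by simp
  have [measurable]: "k \<in> borel_measurable I01" "f \<in> borel_measurable I01"
    using assms by (auto simp: L2_def)
  have int': "integrable I01 (\<lambda>x. (cmod (k x * f x))\<^sup>2)"
    by (rule Bochner_Integration.integrable_bound[OF int])
       (use bd in \<open>auto intro!: AE_I2\<close>)
  then show "(\<lambda>x. k x * f x) \<in> L2"
    unfolding L2_def by auto
  have "(LINT x|I01. (cmod (k x * f x))\<^sup>2) \<le> (LINT x|I01. B\<^sup>2 * (cmod (f x))\<^sup>2)"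
    using int int' bd by (intro integral_mono) auto
  then have "L2_norm (\<lambda>x. k x * f x) \<le> sqrt (B\<^sup>2 * (LINT x|I01. (cmod (f x))\<^sup>2))"
    unfolding L2_norm_def by simp
  then show "L2_norm (\<lambda>x. k x * f x) \<le> B * L2_norm f"
    unfolding L2_norm_def using \<open>B \<ge> 0\<close> by (simp add: real_sqrt_mult)
qed

lemma L2_scale: "f \<in> L2 \<Longrightarrow> (\<lambda>x. c * f x) \<in> L2"
  by (rule L2_mult_bounded(1)[of _ _ "cmod c"]) auto

lemma L2_norm_scale: "L2_norm (\<lambda>x. c * f x) = cmod c * L2_norm f"
  unfolding L2_norm_def by (simp add: norm_mult power_mult_distrib real_sqrt_mult)

lemma L2_diff: "f \<in> L2 \<Longrightarrow> g \<in> L2 \<Longrightarrow> (\<lambda>x. f x - g x) \<in> L2"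
  using L2_add[of f "\<lambda>x. (-1) * g x"] L2_scale[of g "-1"] by simp

lemma L2_sum_fun: "(\<And>j. j \<in> F \<Longrightarrow> f j \<in> L2) \<Longrightarrow> (\<lambda>x. \<Sum>j\<in>F. f j x) \<in> L2"
  by (induction F rule: infinite_finite_induct) (auto intro: L2_add L2_const)

lemma L2_norm_triangle:
  assumes "f \<in> L2" "g \<in> L2"
  shows "L2_norm (\<lambda>x. f x + g x) \<le> L2_norm f + L2_norm g"
proof (rule power2_le_imp_le)
  \<comment> \<open>Expanding the square leaves the integral of the product of the moduli, so
    Cauchy-Schwarz is applied to the moduli themselves.\<close>
  let ?F = "\<lambda>x. complex_of_real (cmod (f x))" and ?G = "\<lambda>x. complex_of_real (cmod (g x))"
  have FG: "?F \<in> L2" "?G \<in> L2" using assms by (auto simp: L2_def)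
  have n: "L2_norm ?F = L2_norm f" "L2_norm ?G = L2_norm g" by (auto simp: L2_norm_def)
  have "(LINT x|I01. cmod (f x) * cmod (g x)) \<le> L2_norm f * L2_norm g"
    using L2_Cauchy_Schwarz[OF FG] unfolding n
    by (simp flip: of_real_mult)
  moreover have int: "integrable I01 (\<lambda>x. cmod (f x) * cmod (g x))"
    using integrable_norm[OF L2_mult_integrable[OF FG]] by (simp add: norm_mult)
  moreover have "(LINT x|I01. (cmod (f x + g x))\<^sup>2) \<le>
      (LINT x|I01. (cmod (f x))\<^sup>2 + 2 * (cmod (f x) * cmod (g x)) + (cmod (g x))\<^sup>2)"
  proof (rule integral_mono)
    fix x
    have "(cmod (f x + g x))\<^sup>2 \<le> (cmod (f x) + cmod (g x))\<^sup>2"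
      by (intro power_mono norm_triangle_ineq) auto
    then show "(cmod (f x + g x))\<^sup>2 \<le> (cmod (f x))\<^sup>2 + 2 * (cmod (f x) * cmod (g x)) + (cmod (g x))\<^sup>2"
      by (simp add: power2_sum)
  qed (use assms int L2_add[OF assms] in \<open>auto simp: L2_def\<close>)
  ultimately show "(L2_norm (\<lambda>x. f x + g x))\<^sup>2 \<le> (L2_norm f + L2_norm g)\<^sup>2"
    unfolding power2_sum L2_norm_sq using assms by (simp add: L2_def)
qed auto

lemma L2_norm_minus: "L2_norm (\<lambda>x. f x - g x) = L2_norm (\<lambda>x. g x - f x)"
  unfolding L2_norm_def by (simp add: norm_minus_commute)

lemma L2_norm_triangle_diff:
  assumes "f \<in> L2" "g \<in> L2" "k \<in> L2"
  shows "L2_norm (\<lambda>x. f x - k x) \<le> L2_norm (\<lambda>x. f x - g x) + L2_norm (\<lambda>x. g x - k x)"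
  using L2_norm_triangle[OF L2_diff[OF assms(1,2)] L2_diff[OF assms(2,3)]] by simp

lemma L2_norm_eq_0_imp_AE:
  assumes "f \<in> L2" "L2_norm f = 0"
  shows "AE x in I01. f x = 0"
proof -
  have "(LINT x|I01. (cmod (f x))\<^sup>2) = 0"
    using assms(2) L2_norm_sq[of f] by simp
  then have "AE x in I01. (cmod (f x))\<^sup>2 = 0"
    using L2_sq_integrable[OF assms(1)] by (subst (asm) integral_nonneg_eq_0_iff_AE) auto
  then show ?thesis by simp
qed

subsection \<open>Density of trigonometric polynomials\<close>

text \<open>The common value of both systems at \<open>h = 1\<close>. In addition,
  \<open>fourier_char 1\<close> parametrises the unit circle on which Stone-Weierstrass is
  used.\<close>

definition fourier_char :: "int \<Rightarrow> real \<Rightarrow> complex" where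
  "fourier_char j x = exp (2 * of_real pi * \<i> * of_real x * of_int j)"

lemma u_sys_eq: "u_sys h j x = of_real (h powr x) * fourier_char j x"
  by (simp add: u_sys_def fourier_char_def)

lemma v_sys_eq: "v_sys h j x = of_real (h powr (- x)) * fourier_char j x"
  by (simp add: v_sys_def fourier_char_def)

lemma fourier_char_add: "fourier_char (j + k) x = fourier_char j x * fourier_char k x"
  by (simp add: fourier_char_def exp_add ring_distribs)

lemma fourier_char_0 [simp]: "fourier_char 0 x = 1"
  by (simp add: fourier_char_def)

lemma fourier_char_at_0 [simp]: "fourier_char j 0 = 1"
  by (simp add: fourier_char_def)

lemma fourier_char_at_1 [simp]: "fourier_char j 1 = 1"
  using exp_integer_2pi[of "of_int j"] by (simp add: fourier_char_def mult_ac)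

lemma fourier_char_plus: "fourier_char j (x + y) = fourier_char j x * fourier_char j y"
  by (simp add: fourier_char_def exp_add ring_distribs)

lemma cnj_fourier_char: "cnj (fourier_char j x) = fourier_char (- j) x"
  by (simp add: fourier_char_def exp_cnj)

lemma norm_fourier_char [simp]: "cmod (fourier_char j x) = 1"
  by (simp add: fourier_char_def)

lemma fourier_char_has_vector_derivative:
  "(fourier_char j has_vector_derivative (2 * of_real pi * \<i> * of_int j * fourier_char j x)) (at x within S)"
proof -
  define c where "c = 2 * of_real pi * \<i> * complex_of_int j"
  have "((\<lambda>z. exp (c * z)) has_field_derivative (c * exp (c * of_real x))) (at (of_real x))"
    by (auto intro!: derivative_eq_intros)
  then have "((\<lambda>x. exp (c * of_real x)) has_vector_derivative (c * exp (c * of_real x))) (at x within S)"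
    by (rule has_vector_derivative_real_field)
  then show ?thesis by (simp add: fourier_char_def[abs_def] c_def mult_ac)
qed

lemma continuous_fourier_char [continuous_intros]: "continuous_on S (fourier_char j)"
  unfolding fourier_char_def by (intro continuous_intros)

lemma fourier_char_L2: "fourier_char j \<in> L2"
  by (intro L2_continuous continuous_intros)

lemma integral_fourier_char: "(LINT x|I01. fourier_char j x) = (if j = 0 then 1 else 0)"
proof (cases "j = 0")
  case True
  then show ?thesis using measure_I01 by (simp del: space_restrict_space)
next
  case False
  define c where "c = 2 * of_real pi * \<i> * complex_of_int j"
  have "c \<noteq> 0" using False by (simp add: c_def)
  have "(fourier_char j has_integral (fourier_char j 1 / c - fourier_char j 0 / c)) {0..1}"
  proof (rule fundamental_theorem_of_calculus)
    fix x :: real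
    have "((\<lambda>x. fourier_char j x / c) has_vector_derivative (c * fourier_char j x / c)) (at x within {0..1})"
      unfolding c_def by (intro has_vector_derivative_divide fourier_char_has_vector_derivative)
    then show "((\<lambda>x. fourier_char j x / c) has_vector_derivative (fourier_char j x)) (at x within {0..1})"
      using \<open>c \<noteq> 0\<close> by simp
  qed simp
  then have "integral {0..1} (fourier_char j) = 0"
    by (simp add: integral_unique)
  then show ?thesis
    using False lebesgue_integral_eq_integral[OF L2_integrable[OF fourier_char_L2[of j]]]
    by (simp add: integral_open_interval_real)
qed

text \<open>Generated one monomial at a time, with repeated frequencies allowed, so that closure
  under sums and products is a plain induction; \<open>trig_poly_eq_sum\<close> collects the
  coefficients once this is done.\<close>

inductive trig_poly :: "(real \<Rightarrow> complex) \<Rightarrow> bool" where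
  zero: "trig_poly (\<lambda>x. 0)"
| step: "trig_poly p \<Longrightarrow> trig_poly (\<lambda>x. c * fourier_char j x + p x)"

lemma trig_poly_add: "trig_poly p \<Longrightarrow> trig_poly q \<Longrightarrow> trig_poly (\<lambda>x. p x + q x)"
proof (induction rule: trig_poly.induct)
  case (step p c j)
  then show ?case using trig_poly.step[of "\<lambda>x. p x + q x" c j] by (simp add: add.assoc)
qed simp

lemma trig_poly_char_mult: "trig_poly p \<Longrightarrow> trig_poly (\<lambda>x. c * fourier_char j x * p x)"
proof (induction rule: trig_poly.induct)
  case (step p d k)
  then show ?case using trig_poly.step[of "\<lambda>x. c * fourier_char j x * p x" "c * d" "j + k"]
    by (simp add: ring_distribs fourier_char_add mult_ac)
qed (simp add: trig_poly.zero)

lemma trig_poly_mult: "trig_poly p \<Longrightarrow> trig_poly q \<Longrightarrow> trig_poly (\<lambda>x. p x * q x)"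
proof (induction rule: trig_poly.induct)
  case (step p c j)
  then show ?case using trig_poly_add[OF trig_poly_char_mult[of q c j] step.IH]
    by (simp add: ring_distribs)
qed (simp add: trig_poly.zero)

lemma trig_poly_char: "trig_poly (\<lambda>x. c * fourier_char j x)"
  using trig_poly.step[OF trig_poly.zero] by simp

lemma trig_poly_const: "trig_poly (\<lambda>x. c)"
  using trig_poly_char[of c 0] by simp

lemma trig_poly_L2: "trig_poly p \<Longrightarrow> p \<in> L2"
  by (induction rule: trig_poly.induct) (auto intro!: L2_add L2_scale L2_const fourier_char_L2)

text \<open>Padding the coefficients with zeros makes one family \<open>a\<close> serve all larger
  index sets, which is the form that the net of finite partial sums asks for.\<close>

lemma trig_poly_eq_sum:
  assumes "trig_poly p"
  shows "\<exists>F a. finite F \<and> (\<forall>G. finite G \<longrightarrow> F \<subseteq> G \<longrightarrow> p = (\<lambda>x. \<Sum>j\<in>G. a j * fourier_char j x))"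
  using assms
proof (induction rule: trig_poly.induct)
  case zero
  show ?case by (rule exI[of _ "{}"], rule exI[of _ "\<lambda>_. 0"]) auto
next
  case (step p c j)
  then obtain F a where F: "finite F"
    "\<And>G. finite G \<Longrightarrow> F \<subseteq> G \<Longrightarrow> p = (\<lambda>x. \<Sum>j\<in>G. a j * fourier_char j x)" by blast
  have "(\<lambda>x. c * fourier_char j x + p x) =
      (\<lambda>x. \<Sum>k\<in>G. (a k + (if k = j then c else 0)) * fourier_char k x)"
    if "finite G" "insert j F \<subseteq> G" for G
  proof
    fix x
    have "(\<Sum>k\<in>G. (a k + (if k = j then c else 0)) * fourier_char k x) =
        p x + (\<Sum>k\<in>G. if k = j then c * fourier_char k x else 0)"
      using that unfolding F(2)[OF that(1), unfolded fun_eq_iff, rule_format, OF order_trans[OF subset_insertI that(2)]]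
        sum.distrib[symmetric] by (intro sum.cong) (auto simp: distrib_right)
    then show "c * fourier_char j x + p x =
        (\<Sum>k\<in>G. (a k + (if k = j then c else 0)) * fourier_char k x)"
      using that by (simp add: add.commute)
  qed
  then show ?case
    using F(1) by (intro exI[of _ "insert j F"] exI[of _ "\<lambda>k. a k + (if k = j then c else 0)"]) auto
qed

text \<open>A real-linear functional on the plane is a combination of real and imaginary part, and
  on the circle these are combinations of z and its conjugate, that is, of the characters 1 and
  -1.\<close>

lemma trig_poly_real_polynomial:
  fixes q :: "complex \<Rightarrow> real"
  assumes "real_polynomial_function q"
  shows "trig_poly (\<lambda>x. of_real (q (fourier_char 1 x)))"
  using assms
proof (induction rule: real_polynomial_function.induct)
  case (linear q)
  interpret bounded_linear q by fact
  have eq: "q z = Re z * q 1 + Im z * q \<i>" for z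
  proof -
    have "z = Re z *\<^sub>R 1 + Im z *\<^sub>R \<i>" by (simp add: complex_eq_iff)
    then have "q z = q (Re z *\<^sub>R 1 + Im z *\<^sub>R \<i>)" by simp
    then show ?thesis by (simp add: add scaleR)
  qed
  have "of_real (q (fourier_char 1 x)) =
      ((of_real (q 1) - \<i> * of_real (q \<i>)) / 2) * fourier_char 1 x +
      ((of_real (q 1) + \<i> * of_real (q \<i>)) / 2) * fourier_char (- 1) x" for x
    by (subst eq) (simp add: complex_eq_iff field_simps flip: cnj_fourier_char)
  then show ?case
    by (simp only:) (intro trig_poly_add trig_poly_char)
qed (simp_all add: trig_poly_const trig_poly_add trig_poly_mult)

text \<open>The closure of the trigonometric polynomials in the norm of \<open>L2\<close>. It is
  enlarged in stages: continuous functions on the circle, indicators of open sets, indicators of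
  measurable sets, simple functions, everything.\<close>

definition trig_approx :: "(real \<Rightarrow> complex) \<Rightarrow> bool" where
  "trig_approx f \<longleftrightarrow> f \<in> L2 \<and> (\<forall>e>0. \<exists>p. trig_poly p \<and> L2_norm (\<lambda>x. f x - p x) < e)"

lemma trig_approxD:
  assumes "trig_approx f"
  shows "f \<in> L2" "e > 0 \<Longrightarrow> \<exists>p. trig_poly p \<and> L2_norm (\<lambda>x. f x - p x) < e"
  using assms by (auto simp: trig_approx_def)

lemma trig_approx_limit:
  assumes "f \<in> L2" "\<And>e. e > 0 \<Longrightarrow> \<exists>g. trig_approx g \<and> L2_norm (\<lambda>x. f x - g x) < e"
  shows "trig_approx f"
  unfolding trig_approx_def
proof (intro conjI allI impI)
  fix e :: real assume "e > 0"
  then obtain g where g: "trig_approx g" "L2_norm (\<lambda>x. f x - g x) < e / 2"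
    using assms(2)[of "e / 2"] by auto
  then obtain p where p: "trig_poly p" "L2_norm (\<lambda>x. g x - p x) < e / 2"
    using \<open>e > 0\<close> trig_approxD(2)[OF g(1), of "e / 2"] by auto
  have "L2_norm (\<lambda>x. f x - p x) < e"
    using L2_norm_triangle_diff[OF assms(1) trig_approxD(1)[OF g(1)] trig_poly_L2[OF p(1)]] g(2) p(2)
    by simp
  with p show "\<exists>p. trig_poly p \<and> L2_norm (\<lambda>x. f x - p x) < e" by blast
qed fact

lemma trig_approx_add:
  assumes "trig_approx f" "trig_approx g"
  shows "trig_approx (\<lambda>x. f x + g x)"
  unfolding trig_approx_def
proof (intro conjI allI impI)
  show "(\<lambda>x. f x + g x) \<in> L2" using assms by (auto simp: trig_approx_def intro: L2_add)
  fix e :: real assume "e > 0"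
  then obtain p q where p: "trig_poly p" "L2_norm (\<lambda>x. f x - p x) < e / 2"
    and q: "trig_poly q" "L2_norm (\<lambda>x. g x - q x) < e / 2"
    using trig_approxD(2)[OF assms(1), of "e / 2"] trig_approxD(2)[OF assms(2), of "e / 2"] by auto
  have "L2_norm (\<lambda>x. (f x - p x) + (g x - q x)) < e"
    using L2_norm_triangle[OF L2_diff[OF trig_approxD(1)[OF assms(1)] trig_poly_L2[OF p(1)]]
        L2_diff[OF trig_approxD(1)[OF assms(2)] trig_poly_L2[OF q(1)]]] p(2) q(2) by simp
  then show "\<exists>r. trig_poly r \<and> L2_norm (\<lambda>x. f x + g x - r x) < e"
    by (intro exI[of _ "\<lambda>x. p x + q x"] conjI trig_poly_add p q) (simp add: algebra_simps)
qed

lemma trig_approx_scale: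
  assumes "trig_approx f"
  shows "trig_approx (\<lambda>x. c * f x)"
  unfolding trig_approx_def
proof (intro conjI allI impI)
  show "(\<lambda>x. c * f x) \<in> L2" using assms by (auto simp: trig_approx_def intro: L2_scale)
  fix e :: real assume "e > 0"
  \<comment> \<open>The added 1 keeps the divisor positive when \<open>c = 0\<close>.\<close>
  then have pos: "e / (cmod c + 1) > 0" by (simp add: add_nonneg_pos)
  then obtain p where p: "trig_poly p" "L2_norm (\<lambda>x. f x - p x) < e / (cmod c + 1)"
    using assms unfolding trig_approx_def by blast
  have "L2_norm (\<lambda>x. c * f x - c * p x) = cmod c * L2_norm (\<lambda>x. f x - p x)"
    unfolding right_diff_distrib[symmetric] by (rule L2_norm_scale)
  also have "\<dots> \<le> (cmod c + 1) * L2_norm (\<lambda>x. f x - p x)"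
    by (intro mult_right_mono) auto
  also have "\<dots> < e"
    using p(2) pos_less_divide_eq[of "cmod c + 1"] by (simp add: mult.commute add_nonneg_pos)
  finally show "\<exists>r. trig_poly r \<and> L2_norm (\<lambda>x. c * f x - r x) < e"
    using trig_poly_char_mult[OF p(1), of c 0] by (intro exI[of _ "\<lambda>x. c * p x"]) auto
qed

lemma trig_approx_0: "trig_approx (\<lambda>x. 0)"
  unfolding trig_approx_def using trig_poly.zero by (fastforce intro!: L2_const simp: L2_norm_def)

lemma trig_approx_sum: "(\<And>y. y \<in> A \<Longrightarrow> trig_approx (f y)) \<Longrightarrow> trig_approx (\<lambda>x. \<Sum>y\<in>A. f y x)"
  by (induction A rule: infinite_finite_induct) (auto intro: trig_approx_0 trig_approx_add)

lemma L2_dominated_convergence: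
  assumes s: "\<And>n. s n \<in> L2" and f: "f \<in> L2" and w: "w \<in> L2"
    and lim: "\<And>x. x \<in> {0<..<1} \<Longrightarrow> (\<lambda>n. s n x) \<longlonglongrightarrow> f x"
    and bound: "\<And>n x. x \<in> {0<..<1} \<Longrightarrow> cmod (f x - s n x) \<le> cmod (w x)"
  shows "(\<lambda>n. L2_norm (\<lambda>x. f x - s n x)) \<longlonglongrightarrow> 0"
proof -
  have "(\<lambda>n. LINT x|I01. (cmod (f x - s n x))\<^sup>2) \<longlonglongrightarrow> (LINT x|I01. 0)"
  proof (rule integral_dominated_convergence[where w="\<lambda>x. (cmod (w x))\<^sup>2"])
    show "(\<lambda>x. (cmod (f x - s n x))\<^sup>2) \<in> borel_measurable I01" for n
      using L2_sq_integrable[OF L2_diff[OF f s]] by (rule borel_measurable_integrable)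
    show "integrable I01 (\<lambda>x. (cmod (w x))\<^sup>2)" using w by (rule L2_sq_integrable)
    show "AE x in I01. (\<lambda>n. (cmod (f x - s n x))\<^sup>2) \<longlonglongrightarrow> 0"
    proof (rule AE_I2)
      fix x assume "x \<in> space I01"
      then have "(\<lambda>n. (cmod (f x - s n x))\<^sup>2) \<longlonglongrightarrow> (cmod (f x - f x))\<^sup>2"
        by (intro tendsto_intros lim) auto
      then show "(\<lambda>n. (cmod (f x - s n x))\<^sup>2) \<longlonglongrightarrow> 0" by simp
    qed
    show "AE x in I01. norm ((cmod (f x - s n x))\<^sup>2) \<le> (cmod (w x))\<^sup>2" for n
      using bound by (auto intro!: AE_I2 power_mono)
  qed auto
  then have "(\<lambda>n. sqrt (LINT x|I01. (cmod (f x - s n x))\<^sup>2)) \<longlonglongrightarrow> sqrt 0"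
    by (intro tendsto_real_sqrt) simp
  then show ?thesis unfolding L2_norm_def by simp
qed

lemma trig_approx_dominated:
  assumes "\<And>n. trig_approx (s n)" "f \<in> L2" "w \<in> L2"
    "\<And>x. x \<in> {0<..<1} \<Longrightarrow> (\<lambda>n. s n x) \<longlonglongrightarrow> f x"
    "\<And>n x. x \<in> {0<..<1} \<Longrightarrow> cmod (f x - s n x) \<le> cmod (w x)"
  shows "trig_approx f"
proof (rule trig_approx_limit)
  fix e :: real assume "e > 0"
  have "(\<lambda>n. L2_norm (\<lambda>x. f x - s n x)) \<longlonglongrightarrow> 0"
    using assms by (intro L2_dominated_convergence[where w=w]) (auto simp: trig_approx_def)
  then have "eventually (\<lambda>n. L2_norm (\<lambda>x. f x - s n x) < e) sequentially"
    using \<open>e > 0\<close> by (auto simp: order_tendsto_iff)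
  then obtain n where "L2_norm (\<lambda>x. f x - s n x) < e"
    using eventually_happens[of _ sequentially] by auto
  then show "\<exists>g. trig_approx g \<and> L2_norm (\<lambda>x. f x - g x) < e"
    using assms(1) by blast
qed fact

text \<open>The interval has length 1, so a uniform error on the circle bounds the \<open>L2\<close>
  error. It bounds it only weakly, hence \<open>e / 2\<close> in the approximation.\<close>

lemma trig_approx_circle:
  fixes \<phi> :: "complex \<Rightarrow> real"
  assumes "continuous_on (sphere 0 1) \<phi>"
  shows "trig_approx (\<lambda>x. of_real (\<phi> (fourier_char 1 x)))"
  unfolding trig_approx_def
proof (intro conjI allI impI)
  have cont: "continuous_on {0..1} (\<lambda>x. complex_of_real (\<phi> (fourier_char 1 x)))"
    by (intro continuous_intros continuous_on_compose2[OF assms]) auto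
  then show "(\<lambda>x. complex_of_real (\<phi> (fourier_char 1 x))) \<in> L2"
    by (rule L2_continuous)
  fix e :: real assume "e > 0"
  obtain q where q: "real_polynomial_function q" "\<And>z. z \<in> sphere 0 1 \<Longrightarrow> \<bar>\<phi> z - q z\<bar> < e / 2"
    using Stone_Weierstrass_real_polynomial_function[OF _ assms, of "e / 2"] \<open>e > 0\<close> by auto
  let ?d = "\<lambda>x. complex_of_real (\<phi> (fourier_char 1 x)) - of_real (q (fourier_char 1 x))"
  have p: "trig_poly (\<lambda>x. of_real (q (fourier_char 1 x)))"
    by (rule trig_poly_real_polynomial[OF q(1)])
  have "?d \<in> L2"
    by (intro L2_diff L2_continuous cont trig_poly_L2 p)
  moreover have "cmod (?d x) \<le> e / 2" for x
    using q(2)[of "fourier_char 1 x"] by (simp flip: of_real_diff)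
  ultimately have "L2_norm ?d \<le> e / 2"
    by (intro L2_bounded(2) L2_measurable)
  with p \<open>e > 0\<close> show "\<exists>p. trig_poly p \<and> L2_norm (\<lambda>x. of_real (\<phi> (fourier_char 1 x)) - p x) < e"
    by (intro exI conjI) auto
qed

text \<open>The circle map identifies only 0 with 1, so it is enough that one of the points is
  interior: then the distance is below 1 and the integer by which the points differ is 0.\<close>

lemma fourier_char_1_inj:
  assumes "fourier_char 1 x = fourier_char 1 y" "x \<in> {0<..<1}" "y \<in> {0..1}"
  shows "x = y"
proof -
  obtain n :: int where "2 * of_real pi * \<i> * of_real x = 2 * of_real pi * \<i> * of_real y + (of_int (2 * n) * pi) * \<i>"
    using assms(1) by (auto simp: fourier_char_def exp_eq)
  then have "of_real (2 * pi) * \<i> * of_real (x - y - of_int n) = 0"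
    by (simp add: algebra_simps)
  then have "x - y - of_int n = 0"
    by (simp only: mult_eq_0_iff of_real_eq_0_iff) simp
  moreover have "\<bar>x - y\<bar> < 1" using assms(2,3) by auto
  ultimately have "\<bar>real_of_int n\<bar> < 1" by simp
  then have "n = 0" by linarith
  then show ?thesis using \<open>x - y - of_int n = 0\<close> by simp
qed

lemma indicator_L2: "A \<in> sets I01 \<Longrightarrow> (\<lambda>x. indicator A x) \<in> L2"
  by (rule L2_bounded(1)[where B=1]) (auto simp: indicator_def)

text \<open>The truncated multiples of the distance to \<open>K\<close>, the image of the complement
  of \<open>T\<close>, are continuous on the circle and converge pointwise to the indicator,
  boundedly by 1.\<close>

lemma trig_approx_open:
  assumes "open T" "T \<subseteq> {0<..<1}"
  shows "trig_approx (indicator T)"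
proof -
  define K where "K = fourier_char 1 ` ({0..1} - T)"
  have K: "compact K" "K \<noteq> {}"
  proof -
    show "compact K"
      unfolding K_def using assms
      by (intro compact_continuous_image continuous_intros compact_diff) auto
    \<comment> \<open>The distance to an empty set is 0 by convention and would not detect
      membership; the point 0 keeps \<open>K\<close> nonempty.\<close>
    have "0 \<in> {0..1} - T" using assms by auto
    then show "K \<noteq> {}" unfolding K_def by blast
  qed
  define \<phi> where "\<phi> n z = min 1 (real n * infdist z K)" for n z
  show ?thesis
  proof (rule trig_approx_dominated[where w="\<lambda>x. 1"])
    show "trig_approx (\<lambda>x. of_real (\<phi> n (fourier_char 1 x)))" for n
      unfolding \<phi>_def by (intro trig_approx_circle continuous_intros)
    show "indicator T \<in> L2"
      using assms by (intro indicator_L2) (auto simp: sets_restrict_space_iff)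
    show "(\<lambda>x. 1) \<in> L2" by (rule L2_const)
    show "cmod (indicator T x - of_real (\<phi> n (fourier_char 1 x))) \<le> cmod 1" for n x
    proof -
      have "\<phi> n (fourier_char 1 x) \<in> {0..1}" by (auto simp: \<phi>_def infdist_nonneg)
      moreover have "indicator T x - complex_of_real (\<phi> n (fourier_char 1 x)) =
          of_real (indicator T x - \<phi> n (fourier_char 1 x))" by (simp add: indicator_def)
      ultimately show ?thesis by (simp only: norm_of_real) (auto simp: indicator_def)
    qed
    show "(\<lambda>n. of_real (\<phi> n (fourier_char 1 x))) \<longlonglongrightarrow> (indicator T x :: complex)"
      if x: "x \<in> {0<..<1}" for x
    proof (cases "x \<in> T")
      case True
      have "fourier_char 1 x \<notin> K"
      proof
        assume "fourier_char 1 x \<in> K"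
        then obtain y where "y \<in> {0..1} - T" "fourier_char 1 x = fourier_char 1 y"
          by (auto simp: K_def)
        then show False using fourier_char_1_inj[of x y] x True by auto
      qed
      then have d: "infdist (fourier_char 1 x) K > 0"
        using K by (simp add: infdist_pos_not_in_closed compact_imp_closed)
      have "eventually (\<lambda>n. real n * infdist (fourier_char 1 x) K \<ge> 1) sequentially"
      proof -
        obtain N where "real N * infdist (fourier_char 1 x) K > 1"
          using reals_Archimedean3[OF d] by blast
        then have "real n * infdist (fourier_char 1 x) K \<ge> 1" if "n \<ge> N" for n
          using mult_right_mono[of "real N" "real n", OF _ less_imp_le[OF d]] that by simp
        then show ?thesis by (auto simp: eventually_sequentially)
      qed
      then have "eventually (\<lambda>n. complex_of_real (\<phi> n (fourier_char 1 x)) = 1) sequentially"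
        by eventually_elim (simp add: \<phi>_def)
      then show ?thesis using True by (simp add: tendsto_eventually)
    next
      case False
      then have "fourier_char 1 x \<in> K" using x by (auto simp: K_def)
      then show ?thesis using False by (simp add: \<phi>_def)
    qed
  qed
qed

text \<open>Outer regularity of Lebesgue measure: the squared error of replacing \<open>A\<close> by
  an open superset \<open>S\<close> is the measure of \<open>S - A\<close>, so the excess is taken
  below the square of \<open>e\<close>.\<close>

lemma trig_approx_indicator:
  assumes A: "A \<in> sets I01"
  shows "trig_approx (indicator A)"
proof (rule trig_approx_limit)
  show "indicator A \<in> L2" by (rule indicator_L2[OF A])
  fix e :: real assume "e > 0"
  have A': "A \<in> sets lebesgue" "A \<subseteq> {0<..<1}" using A by (auto simp: sets_restrict_space_iff)
  obtain T where T: "open T" "A \<subseteq> T" "T - A \<in> lmeasurable" "emeasure lebesgue (T - A) < ennreal (e\<^sup>2)"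
    using sets_lebesgue_outer_open[OF A'(1), of "e\<^sup>2"] \<open>e > 0\<close> by auto
  define S where "S = T \<inter> {0<..<1}"
  have S: "open S" "S \<subseteq> {0<..<1}" "A \<subseteq> S" using T A' by (auto simp: S_def)
  have SA: "S - A \<in> lmeasurable"
    by (rule fmeasurableI2[OF T(3)]) (use S A' in \<open>auto simp: S_def\<close>)
  have "(LINT x|I01. (cmod (indicator A x - indicator S x))\<^sup>2) = (LINT x|I01. indicator (S - A) x)"
    using S by (intro Bochner_Integration.integral_cong) (auto simp: indicator_def)
  also have "\<dots> = measure I01 (S - A)"
    using S by (simp add: space_restrict_space Int_absorb2 subset_iff)
  also have "\<dots> = measure lebesgue (S - A)"
    using S SA by (subst measure_restrict_space) auto
  also have "\<dots> \<le> measure lebesgue (T - A)"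
    using T SA by (intro measure_mono_fmeasurable) (auto simp: S_def)
  also have "\<dots> < e\<^sup>2"
    using T(3,4) \<open>e > 0\<close> by (simp add: emeasure_eq_measure2 ennreal_less_iff)
  finally have "L2_norm (\<lambda>x. indicator A x - indicator S x) < e"
    unfolding L2_norm_def using \<open>e > 0\<close> by (intro real_less_lsqrt) auto
  then show "\<exists>g. trig_approx g \<and> L2_norm (\<lambda>x. indicator A x - g x) < e"
    using trig_approx_open[OF S(1,2)] by blast
qed

text \<open>Simplicity over \<open>I01\<close> restricts the values on the open interval only.
  Cutting off outside makes the decomposition into indicators an identity on the whole line.\<close>

lemma trig_approx_simple:
  assumes "simple_function I01 s"
  shows "trig_approx (\<lambda>x. if x \<in> {0<..<1} then s x else 0)"
proof -
  have fin: "finite (s ` {0<..<1})" and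
    meas: "\<And>y. y \<in> s ` {0<..<1} \<Longrightarrow> s -` {y} \<inter> {0<..<1} \<in> sets I01"
    using assms by (auto simp: simple_function_def space_restrict_space)
  have "(\<lambda>x. if x \<in> {0<..<1} then s x else 0) =
      (\<lambda>x. \<Sum>y\<in>s ` {0<..<1}. y * indicator (s -` {y} \<inter> {0<..<1}) x)"
  proof
    fix x :: real
    show "(if x \<in> {0<..<1} then s x else 0) = (\<Sum>y\<in>s ` {0<..<1}. y * indicator (s -` {y} \<inter> {0<..<1}) x)"
    proof (cases "x \<in> {0<..<1}")
      case True
      then have "(\<Sum>y\<in>s ` {0<..<1}. y * indicator (s -` {y} \<inter> {0<..<1}) x) =
          (\<Sum>y\<in>s ` {0<..<1}. if y = s x then y else 0)"
        by (intro sum.cong) (auto simp: indicator_def)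
      then show ?thesis using True fin by (simp add: sum.delta')
    qed (auto intro!: sum.neutral simp: indicator_def)
  qed
  then show ?thesis
    using meas by (simp only:) (intro trig_approx_sum trig_approx_scale trig_approx_indicator)
qed

theorem trig_approx_L2:
  assumes "f \<in> L2"
  shows "trig_approx f"
proof -
  obtain s where s: "\<And>i. simple_function I01 (s i)"
    "\<And>x. x \<in> space I01 \<Longrightarrow> (\<lambda>i. s i x) \<longlonglongrightarrow> f x"
    "\<And>i x. x \<in> space I01 \<Longrightarrow> dist (s i x) 0 \<le> 2 * dist (f x) 0"
    using borel_measurable_implies_sequence_metric[OF L2_measurable[OF assms], of 0] by blast
  let ?s = "\<lambda>i x. if x \<in> {0<..<1} then s i x else 0"
  show ?thesis
  \<comment> \<open>The factor 3 is 1 for \<open>f\<close> itself plus 2 from the bound on the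
    approximating simple functions.\<close>
  proof (rule trig_approx_dominated[where w="\<lambda>x. 3 * f x" and s="?s"])
    show "trig_approx (?s n)" for n by (rule trig_approx_simple[OF s(1)])
    show "(\<lambda>x. 3 * f x) \<in> L2" by (rule L2_scale[OF assms])
    fix x :: real assume x: "x \<in> {0<..<1}"
    then show "(\<lambda>n. ?s n x) \<longlonglongrightarrow> f x" using s(2) by (simp add: space_restrict_space)
    show "cmod (f x - ?s n x) \<le> cmod (3 * f x)" for n
      using x s(3)[of x n] norm_triangle_ineq4[of "f x" "s n x"]
      by (simp add: space_restrict_space dist_norm norm_mult)
  qed fact
qed

subsection \<open>Expansion in the Riesz basis and integration by parts\<close>

lemma L2_inner_diff_left:
  "f \<in> L2 \<Longrightarrow> g \<in> L2 \<Longrightarrow> k \<in> L2 \<Longrightarrow> L2_inner (\<lambda>x. f x - g x) k = L2_inner f k - L2_inner g k"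
  unfolding L2_inner_def left_diff_distrib
  by (intro Bochner_Integration.integral_diff L2_mult_integrable L2_cnj)

lemma L2_inner_scale_left: "L2_inner (\<lambda>x. c * f x) g = c * L2_inner f g"
  unfolding L2_inner_def by (simp add: mult.assoc)

lemma L2_inner_cnj: "L2_inner g f = cnj (L2_inner f g)"
  unfolding L2_inner_def Bochner_Integration.integral_cnj[symmetric] by (simp add: mult.commute)

lemma L2_inner_sum_left:
  assumes "\<And>j. j \<in> G \<Longrightarrow> w j \<in> L2" "g \<in> L2"
  shows "L2_inner (\<lambda>x. \<Sum>j\<in>G. w j x) g = (\<Sum>j\<in>G. L2_inner (w j) g)"
  unfolding L2_inner_def sum_distrib_right
  using assms by (intro Bochner_Integration.integral_sum L2_mult_integrable L2_cnj)

lemma L2_inner_bound: "f \<in> L2 \<Longrightarrow> g \<in> L2 \<Longrightarrow> cmod (L2_inner f g) \<le> L2_norm f * L2_norm g"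
  unfolding L2_inner_def using L2_Cauchy_Schwarz[of f "\<lambda>x. cnj (g x)"] L2_cnj[of g] L2_norm_cnj[of g] by simp

lemma L2_inner_self: "L2_inner f f = of_real ((L2_norm f)\<^sup>2)"
  unfolding L2_inner_def L2_norm_sq complex_norm_square[symmetric] of_real_power[symmetric]
  by (rule integral_complex_of_real)

lemma L2_inner_AE_cong:
  assumes "AE x in I01. f x = g x" "f \<in> L2" "g \<in> L2" "k \<in> L2"
  shows "L2_inner f k = L2_inner g k"
  unfolding L2_inner_def
  using assms L2_mult_integrable[OF _ L2_cnj[OF assms(4)]]
  by (intro integral_cong_AE) (auto intro: borel_measurable_integrable)

lemma fourier_char_orthonormal:
  "L2_inner (fourier_char j) (fourier_char k) = (if j = k then 1 else 0)"
  unfolding L2_inner_def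
  using integral_fourier_char[of "j - k"] by (simp add: cnj_fourier_char flip: fourier_char_add)

text \<open>The residual \<open>d\<close> of the Fourier sum is orthogonal to the span, and the
  residual \<open>q\<close> of any other combination differs from it by an element \<open>r\<close>
  of the span. So (d, d) = (q, d), and Cauchy-Schwarz compares the norms.\<close>

lemma fourier_best_approx:
  assumes f: "f \<in> L2" and "finite G"
  shows "L2_norm (\<lambda>x. f x - (\<Sum>j\<in>G. L2_inner f (fourier_char j) * fourier_char j x))
    \<le> L2_norm (\<lambda>x. f x - (\<Sum>j\<in>G. a j * fourier_char j x))"
proof -
  define S where "S = (\<lambda>x. \<Sum>j\<in>G. L2_inner f (fourier_char j) * fourier_char j x)"
  define r where "r = (\<lambda>x. \<Sum>j\<in>G. (L2_inner f (fourier_char j) - a j) * fourier_char j x)"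
  define d where "d = (\<lambda>x. f x - S x)"
  define q where "q = (\<lambda>x. f x - (\<Sum>j\<in>G. a j * fourier_char j x))"
  have S: "S \<in> L2" and r: "r \<in> L2"
    unfolding S_def r_def by (intro L2_sum_fun L2_scale fourier_char_L2)+
  have d: "d \<in> L2" unfolding d_def by (intro L2_diff f S)
  have q: "q \<in> L2" unfolding q_def by (intro L2_diff L2_sum_fun L2_scale fourier_char_L2 f)
  have "L2_inner d (fourier_char k) = 0" if "k \<in> G" for k
  proof -
    have "L2_inner S (fourier_char k) = (\<Sum>j\<in>G. L2_inner f (fourier_char j) * (if j = k then 1 else 0))"
      unfolding S_def
      by (subst L2_inner_sum_left) (auto simp: L2_inner_scale_left fourier_char_orthonormal intro!: L2_scale fourier_char_L2)
    also have "\<dots> = L2_inner f (fourier_char k)"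
      using that \<open>finite G\<close> by (simp add: if_distrib cong: if_cong)
    finally show ?thesis
      unfolding d_def using f S by (subst L2_inner_diff_left) (auto intro: fourier_char_L2)
  qed
  then have "L2_inner (fourier_char k) d = 0" if "k \<in> G" for k
    using that L2_inner_cnj[of "fourier_char k" d] by simp
  then have "L2_inner r d = 0"
    unfolding r_def using d
    by (subst L2_inner_sum_left) (auto simp: L2_inner_scale_left intro!: L2_scale fourier_char_L2)
  moreover have "d = (\<lambda>x. q x - r x)"
    unfolding d_def q_def r_def S_def by (simp add: left_diff_distrib sum_subtractf)
  ultimately have "L2_inner d d = L2_inner q d"
    using L2_inner_diff_left[OF q r d] by simp
  then have "(L2_norm d)\<^sup>2 \<le> L2_norm q * L2_norm d"
    using L2_inner_bound[OF q d] by (metis L2_inner_self abs_of_nonneg norm_of_real zero_le_power2)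
  then have "L2_norm d \<le> L2_norm q"
    using L2_norm_nonneg[of d] by (cases "L2_norm d = 0") (auto simp: power2_eq_square mult_le_cancel_right)
  then show ?thesis by (simp add: d_def q_def S_def)
qed

lemma fourier_has_sum:
  assumes f: "f \<in> L2"
  shows "L2_has_sum (\<lambda>j x. L2_inner f (fourier_char j) * fourier_char j x) f"
  unfolding L2_has_sum_def
proof (intro conjI allI)
  show "(\<lambda>x. L2_inner f (fourier_char j) * fourier_char j x) \<in> L2" for j
    by (intro L2_scale fourier_char_L2)
  show "((\<lambda>F. L2_norm (\<lambda>x. (\<Sum>j\<in>F. L2_inner f (fourier_char j) * fourier_char j x) - f x)) \<longlongrightarrow> 0)
      (finite_subsets_at_top UNIV)"
  proof (rule tendstoI)
    fix e :: real assume "e > 0"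
    then obtain p where p: "trig_poly p" "L2_norm (\<lambda>x. f x - p x) < e"
      using trig_approxD(2)[OF trig_approx_L2[OF f]] by blast
    obtain F a where F: "finite F"
      "\<And>G. finite G \<Longrightarrow> F \<subseteq> G \<Longrightarrow> p = (\<lambda>x. \<Sum>j\<in>G. a j * fourier_char j x)"
      using trig_poly_eq_sum[OF p(1)] by blast
    \<comment> \<open>Once \<open>G\<close> contains the frequencies of \<open>p\<close>, the
      Fourier sum over \<open>G\<close> is at least as close to \<open>f\<close> as \<open>p\<close>
      is.\<close>
    have "L2_norm (\<lambda>x. (\<Sum>j\<in>G. L2_inner f (fourier_char j) * fourier_char j x) - f x) < e"
      if "finite G" "F \<subseteq> G" for G
      using fourier_best_approx[OF f that(1), of a] p(2) unfolding F(2)[OF that]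
      by (subst L2_norm_minus) simp
    then show "\<forall>\<^sub>F G in finite_subsets_at_top UNIV.
        dist (L2_norm (\<lambda>x. (\<Sum>j\<in>G. L2_inner f (fourier_char j) * fourier_char j x) - f x)) 0 < e"
      using F(1) unfolding eventually_finite_subsets_at_top by (intro exI[of _ F]) auto
  qed
qed fact

section \<open>The systems u and v: expansion, uniqueness and completeness\<close>

lemma powr_bound: "(h::real) > 0 \<Longrightarrow> x \<in> {0..1} \<Longrightarrow> h powr x \<le> max 1 h"
  by (cases "h \<ge> 1") (use powr_mono[of x 1 h] powr_le_one_le[of h x] in \<open>auto simp: powr_le1\<close>)

lemma continuous_u_sys: "h > 0 \<Longrightarrow> continuous_on S (u_sys h j)"
  unfolding u_sys_eq[abs_def] by (intro continuous_intros) auto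

lemma continuous_v_sys: "h > 0 \<Longrightarrow> continuous_on S (v_sys h j)"
  unfolding v_sys_eq[abs_def] by (intro continuous_intros) auto

lemma u_sys_L2: "h > 0 \<Longrightarrow> u_sys h j \<in> L2"
  by (intro L2_continuous continuous_u_sys)

lemma v_sys_L2: "h > 0 \<Longrightarrow> v_sys h j \<in> L2"
  by (intro L2_continuous continuous_v_sys)

lemma u_v_biorthogonal:
  assumes "h > 0"
  shows "L2_inner (u_sys h j) (v_sys h k) = (if j = k then 1 else 0)"
proof -
  have "u_sys h j x * cnj (v_sys h k x) = fourier_char j x * cnj (fourier_char k x)" for x
    using assms by (simp add: u_sys_eq v_sys_eq powr_minus)
  then show ?thesis using fourier_char_orthonormal[of j k] by (simp add: L2_inner_def)
qed

theorem u_sys_expansion: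
  assumes h: "h > 0" and f: "f \<in> L2"
  shows "L2_has_sum (\<lambda>j x. L2_inner f (v_sys h j) * u_sys h j x) f"
  unfolding L2_has_sum_def
proof (intro conjI allI)
  show "(\<lambda>x. L2_inner f (v_sys h j) * u_sys h j x) \<in> L2" for j
    by (intro L2_scale u_sys_L2 h)
  \<comment> \<open>Moving the weight onto \<open>f\<close> turns pairings with \<open>v_sys\<close>
    into Fourier coefficients of \<open>F\<close>; restoring it multiplies the error by at most
    \<open>max 1 h\<close>.\<close>
  define F where "F = (\<lambda>x. of_real (h powr - x) * f x)"
  have F: "F \<in> L2"
    unfolding F_def
  proof (rule L2_mult_bounded(1)[OF f])
    show "(\<lambda>x. complex_of_real (h powr - x)) \<in> borel_measurable I01"
      using h by (intro continuous_imp_measurable_on_sets_lebesgue continuous_intros) auto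
    show "cmod (complex_of_real (h powr - x)) \<le> max 1 (1 / h)" if "x \<in> {0<..<1}" for x
      using powr_bound[of "1 / h" x] h that unfolding norm_of_real by (simp add: powr_minus powr_divide inverse_eq_divide)
  qed
  have coeff: "L2_inner F (fourier_char j) = L2_inner f (v_sys h j)" for j
    unfolding L2_inner_def F_def v_sys_eq by (simp add: mult_ac)
  define d where "d = (\<lambda>G x. (\<Sum>j\<in>G. L2_inner f (v_sys h j) * fourier_char j x) - F x)"
  have eq: "(\<Sum>j\<in>G. L2_inner f (v_sys h j) * u_sys h j x) - f x = of_real (h powr x) * d G x" for G x
    using h by (simp add: d_def F_def u_sys_eq right_diff_distrib sum_distrib_left mult_ac powr_minus)
  have dL2: "d G \<in> L2" for G
    unfolding d_def by (intro L2_diff F L2_sum_fun L2_scale fourier_char_L2)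
  have le: "L2_norm (\<lambda>x. of_real (h powr x) * d G x) \<le> max 1 h * L2_norm (d G)" for G
  proof (rule L2_mult_bounded(2)[OF dL2])
    show "(\<lambda>x. complex_of_real (h powr x)) \<in> borel_measurable I01"
      using h by (intro continuous_imp_measurable_on_sets_lebesgue continuous_intros) auto
    show "cmod (complex_of_real (h powr x)) \<le> max 1 h" if "x \<in> {0<..<1}" for x
      using powr_bound[of h x] h that by simp
  qed
  have "((\<lambda>G. max 1 h * L2_norm (d G)) \<longlongrightarrow> 0) (finite_subsets_at_top UNIV)"
    using fourier_has_sum[OF F] unfolding L2_has_sum_def d_def coeff by (auto intro: tendsto_mult_right_zero)
  then show "((\<lambda>G. L2_norm (\<lambda>x. (\<Sum>j\<in>G. L2_inner f (v_sys h j) * u_sys h j x) - f x)) \<longlongrightarrow> 0)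
      (finite_subsets_at_top UNIV)"
    unfolding eq by (rule Lim_null_comparison[rotated]) (simp add: le)
qed fact

lemma L2_has_sum_unique:
  assumes "L2_has_sum a s" "L2_has_sum a t"
  shows "AE x in I01. s x = t x"
proof -
  have L2: "s \<in> L2" "t \<in> L2" "\<And>F. (\<lambda>x. \<Sum>j\<in>F. a j x) \<in> L2"
    using assms by (auto simp: L2_has_sum_def intro: L2_sum_fun)
  let ?n = "\<lambda>s F. L2_norm (\<lambda>x. (\<Sum>j\<in>F. a j x) - s x)"
  have "((\<lambda>F. ?n s F + ?n t F) \<longlongrightarrow> 0 + 0) (finite_subsets_at_top UNIV)"
    using assms unfolding L2_has_sum_def by (intro tendsto_add) auto
  moreover have "L2_norm (\<lambda>x. s x - t x) \<le> ?n s F + ?n t F" for F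
    using L2_norm_triangle_diff[OF L2(1,3,2)] by (subst (2) L2_norm_minus)
  ultimately have "L2_norm (\<lambda>x. s x - t x) \<le> 0"
    by (intro tendsto_lowerbound[of _ 0 "finite_subsets_at_top (UNIV::int set)"]) auto
  then have "L2_norm (\<lambda>x. s x - t x) = 0" using L2_norm_nonneg by (simp add: antisym)
  then show ?thesis using L2_norm_eq_0_imp_AE[OF L2_diff[OF L2(1,2)]] by simp
qed

lemma L2_has_sum_L2_sum: "L2_has_sum a s \<Longrightarrow> L2_has_sum a (L2_sum a)"
  unfolding L2_sum_def by (rule someI[of "L2_has_sum a"])

lemma L2_sum_AE_eq: "L2_has_sum a s \<Longrightarrow> AE x in I01. L2_sum a x = s x"
  by (rule L2_has_sum_unique[OF L2_has_sum_L2_sum])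

text \<open>Pairing with \<open>v_sys h k\<close> is continuous, and by biorthogonality every
  partial sum whose index set contains \<open>k\<close> already pairs to \<open>m k\<close>.\<close>

lemma u_sys_coeff:
  assumes h: "h > 0" and s: "L2_has_sum (\<lambda>j x. m j * u_sys h j x) s"
  shows "L2_inner s (v_sys h k) = m k"
proof -
  let ?S = "\<lambda>F x. \<Sum>j\<in>F. m j * u_sys h j x"
  have L2: "s \<in> L2" "\<And>F. ?S F \<in> L2"
    using s by (auto simp: L2_has_sum_def intro: L2_sum_fun)
  have "((\<lambda>F. L2_norm (\<lambda>x. ?S F x - s x) * L2_norm (v_sys h k)) \<longlongrightarrow> 0) (finite_subsets_at_top UNIV)"
    using s by (intro tendsto_mult_left_zero) (simp add: L2_has_sum_def)
  moreover have "cmod (m k - L2_inner s (v_sys h k)) \<le> L2_norm (\<lambda>x. ?S F x - s x) * L2_norm (v_sys h k)"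
    if "finite F" "{k} \<subseteq> F" for F
  proof -
    have "L2_inner (?S F) (v_sys h k) = (\<Sum>j\<in>F. m j * (if j = k then 1 else 0))"
      using h by (subst L2_inner_sum_left)
        (auto simp: L2_inner_scale_left u_v_biorthogonal intro!: L2_scale u_sys_L2 v_sys_L2)
    also have "\<dots> = m k"
      using that by (simp add: if_distrib cong: if_cong)
    finally have "m k - L2_inner s (v_sys h k) = L2_inner (\<lambda>x. ?S F x - s x) (v_sys h k)"
      by (subst L2_inner_diff_left[OF L2(2,1) v_sys_L2[OF h]]) simp
    then show ?thesis using L2_inner_bound[OF L2_diff[OF L2(2,1)] v_sys_L2[OF h]] by simp
  qed
  then have "\<forall>\<^sub>F F in finite_subsets_at_top UNIV. cmod (m k - L2_inner s (v_sys h k)) \<le>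
      L2_norm (\<lambda>x. ?S F x - s x) * L2_norm (v_sys h k)"
    unfolding eventually_finite_subsets_at_top by (intro exI[of _ "{k}"]) auto
  ultimately have "cmod (m k - L2_inner s (v_sys h k)) \<le> 0"
    by (intro tendsto_lowerbound[of _ 0 "finite_subsets_at_top (UNIV::int set)"]) auto
  then show ?thesis by simp
qed

lemma v_sys_complete:
  assumes "h > 0" "f \<in> L2" "\<And>j. L2_inner f (v_sys h j) = 0"
  shows "AE x in I01. f x = 0"
proof -
  have "L2_has_sum (\<lambda>j x. 0) f"
    using u_sys_expansion[OF assms(1,2)] assms(3) by simp
  moreover have "L2_has_sum (\<lambda>j x. 0) (\<lambda>x. 0)"
    by (auto simp: L2_has_sum_def L2_norm_def L2_const)
  ultimately show ?thesis by (rule L2_has_sum_unique)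
qed

section \<open>Primitives of square-integrable functions and integration by parts\<close>

lemma L2_integrable_on: "g \<in> L2 \<Longrightarrow> g integrable_on {0..1}"
  using L2_integrable[of g] integrable_on_lebesgue_on[of "{0<..<1}" g]
  by (simp add: integrable_on_open_interval_real)

lemma L2_integral: "g \<in> L2 \<Longrightarrow> (LINT x|I01. g x) = integral {0..1} g"
  using lebesgue_integral_eq_integral[OF L2_integrable[of g]] by (simp add: integral_open_interval_real)

lemma L2_primitive_continuous: "g \<in> L2 \<Longrightarrow> continuous_on {0..1} (\<lambda>x. integral {0..x} g)"
  by (intro indefinite_integral_continuous_1 L2_integrable_on)

lemma L2_primitive_diff:
  assumes "f \<in> L2" "g \<in> L2" "x \<in> {0..1}"
  shows "integral {0..x} (\<lambda>t. f t - g t) = integral {0..x} f - integral {0..x} g"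
  using assms L2_integrable_on integrable_on_subinterval[of _ "{0..1}" 0 x]
  by (intro Henstock_Kurzweil_Integration.integral_diff) auto

text \<open>Cauchy-Schwarz against the indicator of \<open>{0..x}\<close>, whose norm is at most 1.
  Uniformity in \<open>x\<close> is what makes passing to a primitive continuous on
  \<open>L2\<close>.\<close>

lemma L2_primitive_bound:
  assumes g: "g \<in> L2" and x: "x \<in> {0..1}"
  shows "cmod (integral {0..x} g) \<le> L2_norm g"
proof -
  have *: "(\<lambda>t. indicator {0..x} t) \<in> L2" "L2_norm (\<lambda>t. indicator {0..x} t) \<le> 1"
  proof -
    have "(\<lambda>t. indicator {0..x} t :: complex) \<in> borel_measurable I01"
      by (intro borel_measurable_indicator' measurable_restrict_space1) simp
    then show "(\<lambda>t. indicator {0..x} t) \<in> L2" "L2_norm (\<lambda>t. indicator {0..x} t) \<le> 1"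
      by (auto intro!: L2_bounded[where B=1] simp: indicator_def simp del: borel_measurable_indicator_iff)
  qed
  have "integral {0..x} g = integral {0..1} (\<lambda>t. if t \<in> {0..x} then g t else 0)"
    using x unfolding integral_restrict_Int by (intro arg_cong2[of _ _ _ _ integral]) auto
  also have "(\<lambda>t. if t \<in> {0..x} then g t else 0) = (\<lambda>t. indicator {0..x} t * g t)"
    by (auto simp: indicator_def)
  also have "integral {0..1} \<dots> = (LINT t|I01. indicator {0..x} t * g t)"
    using lebesgue_integral_eq_integral[OF L2_mult_integrable[OF *(1) g]]
    by (simp add: integral_open_interval_real)
  also have "cmod \<dots> \<le> 1 * L2_norm g"
    by (rule order_trans[OF L2_Cauchy_Schwarz[OF *(1) g]]) (intro mult_right_mono *; simp)
  finally show ?thesis by simp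
qed

lemma trig_poly_continuous: "trig_poly p \<Longrightarrow> continuous_on S p"
  by (induction rule: trig_poly.induct) (auto intro!: continuous_intros)

lemma integration_by_parts_continuous:
  fixes p \<phi> \<phi>' :: "real \<Rightarrow> complex"
  assumes p: "continuous_on {0..1} p" and \<phi>': "continuous_on {0..1} \<phi>'"
    and d: "\<And>x. x \<in> {0..1} \<Longrightarrow> (\<phi> has_vector_derivative \<phi>' x) (at x within {0..1})"
  shows "(LINT x|I01. integral {0..x} p * \<phi>' x) + (LINT x|I01. p x * \<phi> x) = integral {0..1} p * \<phi> 1"
proof -
  have \<phi>: "continuous_on {0..1} \<phi>"
    unfolding continuous_on_eq_continuous_within using has_vector_derivative_continuous[OF d] by blast
  have P: "continuous_on {0..1} (\<lambda>x. integral {0..x} p)"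
    by (intro L2_primitive_continuous L2_continuous p)
  have L2: "(\<lambda>x. integral {0..x} p * \<phi>' x) \<in> L2" "(\<lambda>x. p x * \<phi> x) \<in> L2"
    by (intro L2_continuous continuous_intros P p \<phi> \<phi>')+
  \<comment> \<open>The product rule, integrated. The primitive vanishes at 0, so the only boundary
    contribution is at 1.\<close>
  have "((\<lambda>x. integral {0..x} p * \<phi>' x + p x * \<phi> x) has_integral
      (integral {0..1} p * \<phi> 1 - integral {0..0} p * \<phi> 0)) {0..1}"
  proof (rule fundamental_theorem_of_calculus)
    fix x :: real assume x: "x \<in> {0..1}"
    show "((\<lambda>x. integral {0..x} p * \<phi> x) has_vector_derivative
        integral {0..x} p * \<phi>' x + p x * \<phi> x) (at x within {0..1})"
      using has_vector_derivative_mult[OF integral_has_vector_derivative[OF p x] d[OF x]] by simp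
  qed simp
  then have "integral {0..1} (\<lambda>x. integral {0..x} p * \<phi>' x + p x * \<phi> x) = integral {0..1} p * \<phi> 1"
    by (simp add: integral_unique)
  then show ?thesis
    using L2_integral[OF L2_add[OF L2]] L2_integrable[OF L2(1)] L2_integrable[OF L2(2)] by simp
qed

lemma continuous_bound:
  fixes \<phi> :: "real \<Rightarrow> complex"
  assumes "continuous_on {0..1} \<phi>"
  obtains B where "B \<ge> 0" "\<And>x. x \<in> {0..1} \<Longrightarrow> cmod (\<phi> x) \<le> B"
proof -
  have "bounded (\<phi> ` {0..1})"
    using assms by (intro compact_imp_bounded compact_continuous_image) auto
  then obtain B where "B > 0" "\<forall>x\<in>{0..1}. cmod (\<phi> x) \<le> B"
    unfolding bounded_pos by auto
  then show ?thesis using that[of B] by auto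
qed

text \<open>Both sides are continuous in \<open>g\<close>, so it suffices to know the formula for trigonometric polynomials.\<close>

theorem L2_integration_by_parts:
  fixes g \<phi> \<phi>' :: "real \<Rightarrow> complex"
  assumes g: "g \<in> L2" and \<phi>': "continuous_on {0..1} \<phi>'"
    and d: "\<And>x. x \<in> {0..1} \<Longrightarrow> (\<phi> has_vector_derivative \<phi>' x) (at x within {0..1})"
  shows "(LINT x|I01. integral {0..x} g * \<phi>' x) + (LINT x|I01. g x * \<phi> x) = integral {0..1} g * \<phi> 1"
proof -
  have \<phi>: "continuous_on {0..1} \<phi>"
    unfolding continuous_on_eq_continuous_within using has_vector_derivative_continuous[OF d] by blast
  \<comment> \<open>The defect of the formula: additive in \<open>g\<close>, bounded by
    \<open>C\<close> times the norm of \<open>g\<close>, and zero on trigonometric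
    polynomials.\<close>
  define L where "L = (\<lambda>g. (LINT x|I01. integral {0..x} g * \<phi>' x) + (LINT x|I01. g x * \<phi> x) - integral {0..1} g * \<phi> 1)"
  have int: "integrable I01 (\<lambda>x. integral {0..x} g * \<phi>' x)" "integrable I01 (\<lambda>x. g x * \<phi> x)"
    if "g \<in> L2" for g
    using that L2_mult_integrable[OF L2_continuous[OF L2_primitive_continuous] L2_continuous[OF \<phi>']]
      L2_mult_integrable[OF _ L2_continuous[OF \<phi>]] by blast+
  have Ldiff: "L (\<lambda>x. f x - g x) = L f - L g" if "f \<in> L2" "g \<in> L2" for f g
  proof -
    have "(LINT x|I01. integral {0..x} (\<lambda>t. f t - g t) * \<phi>' x) =
        (LINT x|I01. integral {0..x} f * \<phi>' x - integral {0..x} g * \<phi>' x)"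
      using that by (intro Bochner_Integration.integral_cong refl)
        (simp add: L2_primitive_diff left_diff_distrib)
    also have "\<dots> = (LINT x|I01. integral {0..x} f * \<phi>' x) - (LINT x|I01. integral {0..x} g * \<phi>' x)"
      by (intro Bochner_Integration.integral_diff int that)
    finally have "(LINT x|I01. integral {0..x} (\<lambda>t. f t - g t) * \<phi>' x) =
        (LINT x|I01. integral {0..x} f * \<phi>' x) - (LINT x|I01. integral {0..x} g * \<phi>' x)" .
    moreover have "(LINT x|I01. (f x - g x) * \<phi> x) = (LINT x|I01. f x * \<phi> x) - (LINT x|I01. g x * \<phi> x)"
      unfolding left_diff_distrib by (intro Bochner_Integration.integral_diff int that)
    ultimately show ?thesis
      using that by (simp add: L_def L2_primitive_diff left_diff_distrib)
  qed
  obtain B where B: "B \<ge> 0" "\<And>x. x \<in> {0..1} \<Longrightarrow> cmod (\<phi> x) \<le> B"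
    using continuous_bound[OF \<phi>] by blast
  define C where "C = L2_norm \<phi>' + L2_norm \<phi> + B"
  have Lbound: "cmod (L g) \<le> C * L2_norm g" if g: "g \<in> L2" for g
  proof -
    have P: "(\<lambda>x. integral {0..x} g) \<in> L2" "L2_norm (\<lambda>x. integral {0..x} g) \<le> L2_norm g"
      using g L2_continuous[OF L2_primitive_continuous[OF g]]
      by (auto intro!: L2_bounded(2) L2_measurable L2_primitive_bound)
    have "cmod (LINT x|I01. integral {0..x} g * \<phi>' x) \<le> L2_norm g * L2_norm \<phi>'"
      by (rule order_trans[OF L2_Cauchy_Schwarz[OF P(1) L2_continuous[OF \<phi>']]])
        (intro mult_right_mono P L2_norm_nonneg)
    moreover have "cmod (LINT x|I01. g x * \<phi> x) \<le> L2_norm g * L2_norm \<phi>"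
      by (rule L2_Cauchy_Schwarz[OF g L2_continuous[OF \<phi>]])
    moreover have "cmod (integral {0..1} g * \<phi> 1) \<le> L2_norm g * B"
      unfolding norm_mult using L2_primitive_bound[OF g, of 1] B by (intro mult_mono) auto
    moreover have "cmod (a + b - c) \<le> cmod a + cmod b + cmod c" for a b c :: complex
      using norm_triangle_ineq4[of "a + b" c] norm_triangle_ineq[of a b] by linarith
    ultimately have "cmod (L g) \<le> L2_norm g * L2_norm \<phi>' + L2_norm g * L2_norm \<phi> + L2_norm g * B"
      unfolding L_def by (meson add_mono order_trans)
    then show ?thesis by (simp add: C_def algebra_simps)
  qed
  have "C \<ge> 0" using B by (simp add: C_def)
  have "cmod (L g) \<le> 0 + e" if "e > 0" for e
  proof -
    \<comment> \<open>Dividing by \<open>C + 1\<close> covers \<open>C = 0\<close>.\<close>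
    have "e / (C + 1) > 0" using that \<open>C \<ge> 0\<close> by simp
    then obtain p where p: "trig_poly p" "L2_norm (\<lambda>x. g x - p x) < e / (C + 1)"
      using trig_approxD(2)[OF trig_approx_L2[OF g]] by blast
    have "L p = 0"
      unfolding L_def using integration_by_parts_continuous[OF trig_poly_continuous[OF p(1)] \<phi>' d] by simp
    then have "L g = L (\<lambda>x. g x - p x)" using Ldiff[OF g trig_poly_L2[OF p(1)]] by simp
    also have "cmod \<dots> \<le> C * L2_norm (\<lambda>x. g x - p x)"
      by (intro Lbound L2_diff g trig_poly_L2 p)
    also have "\<dots> \<le> (C + 1) * L2_norm (\<lambda>x. g x - p x)"
      by (intro mult_right_mono) auto
    also have "\<dots> \<le> e" using p(2) \<open>C \<ge> 0\<close> by (simp add: pos_less_divide_eq mult.commute)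
    finally show ?thesis by simp
  qed
  then have "cmod (L g) \<le> 0" by (rule field_le_epsilon)
  then show ?thesis by (simp add: L_def)
qed

subsection \<open>Weak derivatives\<close>

lemma L2_integration_by_parts_affine:
  fixes g \<phi> \<phi>' :: "real \<Rightarrow> complex"
  assumes g: "g \<in> L2" and \<phi>': "continuous_on {0..1} \<phi>'"
    and d: "\<And>x. x \<in> {0..1} \<Longrightarrow> (\<phi> has_vector_derivative \<phi>' x) (at x within {0..1})"
  shows "(LINT x|I01. (c + integral {0..x} g) * \<phi>' x) + (LINT x|I01. g x * \<phi> x) =
    (c + integral {0..1} g) * \<phi> 1 - c * \<phi> 0"
proof -
  have L2: "\<phi>' \<in> L2" "(\<lambda>x. integral {0..x} g) \<in> L2"
    by (intro L2_continuous \<phi>' L2_primitive_continuous g)+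
  have "(\<phi>' has_integral (\<phi> 1 - \<phi> 0)) {0..1}"
    using d by (intro fundamental_theorem_of_calculus) auto
  then have FTC: "(LINT x|I01. \<phi>' x) = \<phi> 1 - \<phi> 0"
    by (simp add: L2_integral[OF L2(1)] integral_unique)
  have "(LINT x|I01. (c + integral {0..x} g) * \<phi>' x) =
      (LINT x|I01. c * \<phi>' x) + (LINT x|I01. integral {0..x} g * \<phi>' x)"
    unfolding distrib_right
    by (intro Bochner_Integration.integral_add L2_mult_integrable L2 L2_const)
  also have "(LINT x|I01. c * \<phi>' x) = c * (\<phi> 1 - \<phi> 0)"
    by (simp add: FTC)
  finally have eq: "(LINT x|I01. (c + integral {0..x} g) * \<phi>' x) =
      c * (\<phi> 1 - \<phi> 0) + (LINT x|I01. integral {0..x} g * \<phi>' x)" .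
  show ?thesis
    unfolding eq using L2_integration_by_parts[OF g \<phi>' d] by (simp add: algebra_simps)
qed

text \<open>Integrating by parts against the characters removes both the primitive and its boundary
  value, so all Fourier coefficients of \<open>g\<close> vanish; completeness at
  \<open>h = 1\<close> concludes.\<close>

lemma L2_primitive_zero:
  assumes g: "g \<in> L2" and "\<And>x. x \<in> {0..1} \<Longrightarrow> integral {0..x} g = 0"
  shows "AE x in I01. g x = 0"
proof (rule v_sys_complete[of 1])
  fix j
  have zero: "(LINT x|I01. integral {0..x} g * (2 * of_real pi * \<i> * of_int (- j) * fourier_char (- j) x)) = (LINT x|I01. 0)"
    by (intro Bochner_Integration.integral_cong) (auto simp: assms)
  have "continuous_on {0..1} (\<lambda>x. 2 * of_real pi * \<i> * of_int (- j) * fourier_char (- j) x)"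
    by (intro continuous_intros)
  from L2_integration_by_parts[OF g this fourier_char_has_vector_derivative, unfolded zero]
  have "(LINT x|I01. g x * fourier_char (- j) x) = 0"
    using assms(2)[of 1] by simp
  then show "L2_inner g (v_sys 1 j) = 0"
    by (simp add: L2_inner_def v_sys_eq cnj_fourier_char)
qed (use g in auto)

section \<open>Smooth functions with support inside the interval\<close>

definition flat_exp :: "real poly \<Rightarrow> real \<Rightarrow> real" where
  "flat_exp P y = (if y > 0 then poly P (1 / y) * exp (- (1 / y)) else 0)"

lemma poly_times_exp_minus_tendsto_0: "((\<lambda>t. poly P t * exp (- t)) \<longlongrightarrow> (0::real)) at_top"
proof -
  have "((\<lambda>t. \<Sum>i\<le>degree P. coeff P i * (t ^ i / exp t)) \<longlongrightarrow> (\<Sum>i\<le>degree P. coeff P i * 0)) at_top"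
    by (intro tendsto_intros tendsto_power_div_exp_0)
  then show ?thesis
    by (simp add: poly_altdef exp_minus sum_distrib_right divide_inverse mult.assoc)
qed

text \<open>With t = 1/y one has d/dy = -t^2 d/dt, which sends P(t) exp(-t) to t^2 (P - P')(t)
  exp(-t). The polynomial parameter is there so that differentiation stays within the family. At 0
  the exponential beats every power of t.\<close>

lemma flat_exp_has_derivative:
  "(flat_exp P has_field_derivative flat_exp ([:0, 0, 1:] * (P - pderiv P)) y) (at y)"
proof (cases y "0::real" rule: linorder_cases)
  case less
  have "((\<lambda>_. 0) has_field_derivative 0) (at y)" by simp
  then have "(flat_exp P has_field_derivative 0) (at y)"
    by (rule has_field_derivative_transform_within_open[where S="{..<0}"])
      (use less in \<open>auto simp: flat_exp_def\<close>)
  then show ?thesis using less by (simp add: flat_exp_def)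
next
  case greater
  have "((\<lambda>y. poly P (1 / y) * exp (- (1 / y))) has_field_derivative
      flat_exp ([:0, 0, 1:] * (P - pderiv P)) y) (at y)"
    using greater by (auto intro!: derivative_eq_intros DERIV_chain2[OF poly_DERIV]
        simp: flat_exp_def field_simps power2_eq_square)
  then show ?thesis
    by (rule has_field_derivative_transform_within_open[where S="{0<..}"])
      (use greater in \<open>auto simp: flat_exp_def\<close>)
next
  case equal
  \<comment> \<open>The difference quotient at 0 carries an extra factor 1/y = t, which is the
    multiplication of \<open>P\<close> by \<open>[:0, 1:]\<close>.\<close>
  have "((\<lambda>t. poly ([:0, 1:] * P) t * exp (- t)) \<longlongrightarrow> 0) at_top"
    by (rule poly_times_exp_minus_tendsto_0)
  moreover have "eventually (\<lambda>t. poly ([:0, 1:] * P) t * exp (- t) = flat_exp P (inverse t) / inverse t) at_top"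
    using eventually_gt_at_top[of 0]
    by eventually_elim (simp add: flat_exp_def field_simps)
  ultimately have "((\<lambda>t. flat_exp P (inverse t) / inverse t) \<longlongrightarrow> 0) at_top"
    by (rule Lim_transform_eventually)
  then have right: "((\<lambda>y. flat_exp P y / y) \<longlongrightarrow> 0) (at_right 0)"
    by (simp add: filterlim_at_right_to_top)
  have "eventually (\<lambda>y. 0 = flat_exp P y / y) (at_left 0)"
    by (simp add: eventually_at_filter flat_exp_def)
  then have left: "((\<lambda>y. flat_exp P y / y) \<longlongrightarrow> 0) (at_left 0)"
    by (rule Lim_transform_eventually[OF tendsto_const])
  show ?thesis
    using left right equal
    by (simp add: has_field_derivative_iff filterlim_at_split flat_exp_def)
qed

text \<open>A class closed under differentiation, so that its members are smooth without a Leibniz rule for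
  higher derivatives.\<close>

inductive flat_alg :: "(real \<Rightarrow> real) \<Rightarrow> bool" where
  const: "flat_alg (\<lambda>x. c)"
| flat: "flat_alg (\<lambda>x. flat_exp P (c * x + d))"
| add: "flat_alg f \<Longrightarrow> flat_alg g \<Longrightarrow> flat_alg (\<lambda>x. f x + g x)"
| mult: "flat_alg f \<Longrightarrow> flat_alg g \<Longrightarrow> flat_alg (\<lambda>x. f x * g x)"

lemma flat_alg_derivative:
  "flat_alg f \<Longrightarrow> \<exists>f'. flat_alg f' \<and> (\<forall>x. (f has_field_derivative f' x) (at x))"
proof (induction rule: flat_alg.induct)
  case (const c)
  show ?case by (intro exI[of _ "\<lambda>x. 0"]) (auto intro: flat_alg.const)
next
  case (flat P c d)
  have "((\<lambda>x. flat_exp P (c * x + d)) has_field_derivative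
      flat_exp ([:0, 0, 1:] * (P - pderiv P)) (c * x + d) * c) (at x)" for x
    by (rule DERIV_chain2[OF flat_exp_has_derivative]) (auto intro!: derivative_eq_intros)
  then show ?case
    by (intro exI[of _ "\<lambda>x. flat_exp ([:0, 0, 1:] * (P - pderiv P)) (c * x + d) * c"] conjI allI
        flat_alg.mult flat_alg.flat flat_alg.const)
next
  case (add f g)
  then obtain f' g' where "flat_alg f'" "flat_alg g'"
    "\<And>x. (f has_field_derivative f' x) (at x)" "\<And>x. (g has_field_derivative g' x) (at x)" by blast
  then show ?case
    by (intro exI[of _ "\<lambda>x. f' x + g' x"]) (auto intro!: flat_alg.add DERIV_add)
next
  case (mult f g)
  then obtain f' g' where "flat_alg f'" "flat_alg g'"
    "\<And>x. (f has_field_derivative f' x) (at x)" "\<And>x. (g has_field_derivative g' x) (at x)" by blast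
  with mult.hyps show ?case
    by (intro exI[of _ "\<lambda>x. f' x * g x + g' x * f x"])
      (auto intro!: flat_alg.add flat_alg.mult DERIV_mult)
qed

lemma flat_alg_higher_deriv: "flat_alg f \<Longrightarrow> flat_alg ((deriv ^^ n) f)"
proof (induction n)
  case (Suc n)
  then obtain f' where f': "flat_alg f'" "\<forall>x. ((deriv ^^ n) f has_field_derivative f' x) (at x)"
    using flat_alg_derivative by blast
  then have "deriv ((deriv ^^ n) f) = f'" by (intro ext DERIV_imp_deriv) blast
  then show ?case using f'(1) by simp
qed simp

lemma flat_alg_differentiable: "flat_alg f \<Longrightarrow> f field_differentiable at x"
  using flat_alg_derivative by (auto simp: field_differentiable_def)

lemma flat_alg_continuous: "flat_alg f \<Longrightarrow> continuous_on S f"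
  by (intro continuous_at_imp_continuous_on ballI field_differentiable_imp_continuous_at flat_alg_differentiable)

text \<open>Zero mean is what makes the primitive vanish again beyond the support of
  \<open>f\<close>, and the strict bounds keep its closed support away from 0 and 1. This supplies
  test functions with prescribed derivative.\<close>

lemma test_fun_primitive:
  assumes f: "flat_alg f" and supp: "\<And>x. x \<notin> {\<alpha><..<\<beta>} \<Longrightarrow> f x = 0" and ab: "0 < \<alpha>" "\<alpha> \<le> \<beta>" "\<beta> < 1"
    and int: "integral {0..1} f = 0"
  shows "test_fun (\<lambda>x. integral {0..x} f)" "deriv (\<lambda>x. integral {0..x} f) = f"
proof -
  let ?\<phi> = "\<lambda>x. integral {0..x} f"
  have lo: "?\<phi> x = 0" if "x \<le> \<alpha>" for x
    using integral_cong[of "{0..x}" f "\<lambda>_. 0"] supp that by auto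
  have beyond: "?\<phi> x = ?\<phi> \<beta>" if "x \<ge> \<beta>" for x
  proof -
    have "?\<phi> \<beta> + integral {\<beta>..x} f = ?\<phi> x"
      using that ab by (intro Henstock_Kurzweil_Integration.integral_combine
          integrable_continuous_real flat_alg_continuous f) auto
    moreover have "integral {\<beta>..x} f = 0"
      using integral_cong[of "{\<beta>..x}" f "\<lambda>_. 0"] supp by auto
    ultimately show ?thesis by simp
  qed
  have hi: "?\<phi> x = 0" if "x \<ge> \<beta>" for x
    using beyond[OF that] beyond[of 1] ab int by simp
  have deriv: "(?\<phi> has_field_derivative f x) (at x)" for x
  proof (cases "x > 0")
    case True
    have "(?\<phi> has_field_derivative f x) (at x within {0..x + 1})"
      using True by (intro integral_has_real_derivative flat_alg_continuous f) auto
    moreover have "at x within {0..x + 1} = at x"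
      using True by (intro at_within_interior) auto
    ultimately show ?thesis by simp
  next
    \<comment> \<open>Differentiation of the indefinite integral is available only to the right of
      0. Further left the primitive is identically zero, and this persists up to
      \<open>\<alpha>\<close>.\<close>
    case False
    have "((\<lambda>_. 0) has_field_derivative 0) (at x)" by simp
    then have "(?\<phi> has_field_derivative 0) (at x)"
      by (rule has_field_derivative_transform_within_open[where S="{..<\<alpha>}"])
        (use lo False ab in auto)
    then show ?thesis using supp[of x] False ab by simp
  qed
  then show d: "deriv ?\<phi> = f" by (auto intro: DERIV_imp_deriv)
  have "(deriv ^^ n) ?\<phi> field_differentiable at x" for n x
  proof (cases n)
    case 0
    then show ?thesis using deriv by (auto simp: field_differentiable_def)
  next
    case (Suc m)
    then have "(deriv ^^ n) ?\<phi> = (deriv ^^ m) f" by (simp only: funpow_Suc_right o_apply d)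
    then show ?thesis using flat_alg_higher_deriv[OF f] by (simp add: flat_alg_differentiable)
  qed
  moreover have "closure {x. ?\<phi> x \<noteq> 0} \<subseteq> {\<alpha>..\<beta>}"
  proof (rule closure_minimal)
    show "{x. ?\<phi> x \<noteq> 0} \<subseteq> {\<alpha>..\<beta>}"
    proof
      fix x assume "x \<in> {x. ?\<phi> x \<noteq> 0}"
      then have "\<not> x \<le> \<alpha>" "\<not> x \<ge> \<beta>" using lo[of x] hi[of x] by blast+
      then show "x \<in> {\<alpha>..\<beta>}" by simp
    qed
  qed simp
  ultimately show "test_fun ?\<phi>"
    unfolding test_fun_def using ab by auto
qed

text \<open>A smooth approximation of the indicator of (a, b): as the scale grows, both exponentials
  tend to 1 inside. \<open>Suc n\<close> avoids the scale 0, and the arguments are spelled as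
  \<open>c * x + d\<close> to match the generator \<open>flat\<close> of
  \<open>flat_alg\<close>.\<close>

definition plateau :: "real \<Rightarrow> real \<Rightarrow> nat \<Rightarrow> real \<Rightarrow> real" where
  "plateau a b n x = flat_exp 1 (real (Suc n) * x + - real (Suc n) * a) * flat_exp 1 (- real (Suc n) * x + real (Suc n) * b)"

lemma flat_alg_plateau: "flat_alg (plateau a b n)"
  unfolding plateau_def[abs_def] by (intro flat_alg.mult flat_alg.flat)

lemma plateau_eq: "plateau a b n x = (if x \<in> {a<..<b}
    then exp (- (1 / (real (Suc n) * (x - a)))) * exp (- (1 / (real (Suc n) * (b - x)))) else 0)"
proof -
  have e: "real (Suc n) * x + - real (Suc n) * a = real (Suc n) * (x - a)"
    "- real (Suc n) * x + real (Suc n) * b = real (Suc n) * (b - x)"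
    by (simp_all only: right_diff_distrib)
  show ?thesis
    unfolding plateau_def e flat_exp_def by (auto simp: zero_less_mult_iff simp del: of_nat_Suc)
qed

lemma plateau_bounds: "0 \<le> plateau a b n x" "plateau a b n x \<le> 1"
  unfolding plateau_eq by (auto intro!: mult_le_one simp del: of_nat_Suc)

lemma plateau_tendsto: "(\<lambda>n. plateau a b n x) \<longlonglongrightarrow> indicator {a<..<b} x"
proof (cases "x \<in> {a<..<b}")
  case True
  have "(\<lambda>n. exp (- (1 / (real (Suc n) * c)))) \<longlonglongrightarrow> 1" for c
  proof -
    have "(\<lambda>n. inverse (real (Suc n)) * inverse c) \<longlonglongrightarrow> 0"
      by (intro tendsto_mult_left_zero LIMSEQ_inverse_real_of_nat)
    then have "(\<lambda>n. exp (- (inverse (real (Suc n)) * inverse c))) \<longlonglongrightarrow> exp (- 0)"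
      by (intro tendsto_intros)
    then show ?thesis by (simp add: divide_inverse)
  qed
  from tendsto_mult[OF this this] show ?thesis using True unfolding plateau_eq by simp
qed (auto simp: plateau_eq)

lemma LINT_plateau_tendsto:
  assumes g: "g \<in> L2" and ab: "0 < a" "a < b" "b < 1"
  shows "(\<lambda>n. LINT x|I01. g x * of_real (plateau a b n x)) \<longlonglongrightarrow> integral {a..b} g"
proof -
  have ind: "(\<lambda>x. indicator {a<..<b} x) \<in> L2"
    using ab by (intro indicator_L2) (auto simp: sets_restrict_space_iff)
  have "(\<lambda>n. LINT x|I01. g x * of_real (plateau a b n x)) \<longlonglongrightarrow> (LINT x|I01. g x * indicator {a<..<b} x)"
  proof (rule integral_dominated_convergence[where w="\<lambda>x. cmod (g x)"])
    show "(\<lambda>x. g x * complex_of_real (plateau a b n x)) \<in> borel_measurable I01" for n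
      by (intro borel_measurable_integrable L2_mult_integrable g L2_continuous continuous_intros
          flat_alg_continuous flat_alg_plateau)
    show "(\<lambda>x. g x * indicator {a<..<b} x) \<in> borel_measurable I01"
      by (intro borel_measurable_integrable L2_mult_integrable g ind)
    show "integrable I01 (\<lambda>x. cmod (g x))"
      by (intro integrable_norm L2_integrable g)
    show "AE x in I01. (\<lambda>n. g x * of_real (plateau a b n x)) \<longlonglongrightarrow> g x * indicator {a<..<b} x"
    proof (rule AE_I2)
      fix x
      have "(\<lambda>n. g x * of_real (plateau a b n x)) \<longlonglongrightarrow> g x * of_real (indicator {a<..<b} x)"
        by (intro tendsto_intros plateau_tendsto)
      moreover have "complex_of_real (indicator {a<..<b} x) = indicator {a<..<b} x"
        by (simp add: indicator_def)
      ultimately show "(\<lambda>n. g x * of_real (plateau a b n x)) \<longlonglongrightarrow> g x * indicator {a<..<b} x"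
        by (simp only:)
    qed
    show "AE x in I01. norm (g x * of_real (plateau a b n x)) \<le> cmod (g x)" for n
      using plateau_bounds by (intro AE_I2) (simp add: norm_mult mult_left_le)
  qed
  also have "(LINT x|I01. g x * indicator {a<..<b} x) = integral {0<..<1} (\<lambda>x. g x * indicator {a<..<b} x)"
    by (intro lebesgue_integral_eq_integral L2_mult_integrable g ind) auto
  also have "(\<lambda>x. g x * indicator {a<..<b} x) = (\<lambda>x. if x \<in> {a<..<b} then g x else 0)"
    by (auto simp: indicator_def)
  also have "integral {0<..<1} \<dots> = integral {a<..<b} g"
    unfolding integral_restrict_Int using ab by (intro arg_cong2[of _ _ _ _ integral]) auto
  finally show ?thesis by (simp add: integral_open_interval_real)
qed

text \<open>The du Bois-Reymond argument. Subtracting from a plateau its share of a fixed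
  \<open>\<eta>\<close> leaves mean zero, hence the derivative of a test function, which
  \<open>w\<close> annihilates. So \<open>w - c\<close> annihilates all plateaus, its integrals over
  all [a, b] vanish in the limit, and its primitive is zero.\<close>

lemma has_weak_deriv_0_imp_const:
  assumes w: "w \<in> L2" and weak: "has_weak_deriv w (\<lambda>x. 0)"
  shows "\<exists>c. AE x in I01. w x = c"
proof -
  define m where "m = (\<lambda>\<psi>. LINT x|I01. complex_of_real (\<psi> x))"
  \<comment> \<open>Some plateau has nonzero mass because the masses tend to 3/4 - 1/4; no single
    mass has to be computed.\<close>
  have "(\<lambda>n. LINT x|I01. 1 * complex_of_real (plateau (1/4) (3/4) n x)) \<longlonglongrightarrow> integral {1/4..3/4::real} (\<lambda>x. 1)"
    by (intro LINT_plateau_tendsto L2_const) auto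
  then have lim: "(\<lambda>n. m (plateau (1/4) (3/4) n)) \<longlonglongrightarrow> 1/2"
    by (simp add: m_def scaleR_conv_of_real)
  have "\<not> (\<forall>N. m (plateau (1/4) (3/4) N) = 0)"
  proof
    assume "\<forall>N. m (plateau (1/4) (3/4) N) = 0"
    then show False using lim by (simp add: LIMSEQ_const_iff)
  qed
  then obtain N where N: "m (plateau (1/4) (3/4) N) \<noteq> 0" by blast
  define \<eta> where "\<eta> = plateau (1/4) (3/4) N"
  define c where "c = (LINT x|I01. w x * of_real (\<eta> x)) / m \<eta>"
  define g where "g = (\<lambda>x. w x - c)"
  have g: "g \<in> L2" unfolding g_def by (intro L2_diff w L2_const)
  have ofreal: "complex_of_real (LINT x|I01. \<psi> x) = m \<psi>" for \<psi> unfolding m_def by simp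
  have zero: "(LINT x|I01. g x * of_real (plateau a b n x)) = 0" if ab: "0 < a" "a < b" "b < 1" for a b n
  proof -
    define \<psi> where "\<psi> = plateau a b n"
    \<comment> \<open>Defined as a real number because test functions are real-valued, although
      \<open>m\<close> takes complex values.\<close>
    define r where "r = (LINT x|I01. \<psi> x) / (LINT x|I01. \<eta> x)"
    define \<theta> where "\<theta> = (\<lambda>x. \<psi> x + (- r) * \<eta> x)"
    have r: "of_real r = m \<psi> / m \<eta>" unfolding r_def by (simp add: ofreal)
    have flat: "flat_alg \<psi>" "flat_alg \<eta>" "flat_alg \<theta>"
      unfolding \<theta>_def \<psi>_def \<eta>_def by (intro flat_alg.add flat_alg.mult flat_alg.const flat_alg_plateau)+
    have L2: "(\<lambda>x. of_real (\<psi> x)) \<in> L2" "(\<lambda>x. of_real (\<eta> x)) \<in> L2" "(\<lambda>x. of_real (\<theta> x)) \<in> L2"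
      by (intro L2_continuous continuous_intros flat_alg_continuous flat)+
    have split: "(LINT x|I01. v x * of_real (\<theta> x)) =
        (LINT x|I01. v x * of_real (\<psi> x)) - of_real r * (LINT x|I01. v x * of_real (\<eta> x))"
      if "v \<in> L2" for v :: "real \<Rightarrow> complex"
    proof -
      have "(\<lambda>x. v x * of_real (\<theta> x)) = (\<lambda>x. v x * of_real (\<psi> x) - of_real r * (v x * of_real (\<eta> x)))"
        by (auto simp: \<theta>_def algebra_simps)
      then show ?thesis
        using L2_mult_integrable[OF that L2(1)] L2_mult_integrable[OF that L2(2)] by simp
    qed
    have "m \<theta> = 0"
      using split[OF L2_const[of 1]] N r by (simp add: m_def \<eta>_def)
    then have "integral {0..1} (\<lambda>x. complex_of_real (\<theta> x)) = 0"
      unfolding m_def L2_integral[OF L2(3)] .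
    moreover have "((\<lambda>x. complex_of_real (\<theta> x)) has_integral of_real (integral {0..1} \<theta>)) {0..1}"
      by (intro has_integral_of_real integrable_integral integrable_continuous_real flat_alg_continuous flat)
    ultimately have int0: "integral {0..1} \<theta> = 0"
      by (simp add: integral_unique)
    \<comment> \<open>The hull of the two supports still lies strictly inside the unit
      interval.\<close>
    have supp: "\<theta> x = 0" if "x \<notin> {min a (1/4)<..<max b (3/4)}" for x
      using that by (auto simp: \<theta>_def \<psi>_def \<eta>_def plateau_eq)
    have "0 < min a (1/4)" "min a (1/4) \<le> max b (3/4)" "max b (3/4) < 1" using ab by auto
    then have prim: "test_fun (\<lambda>x. integral {0..x} \<theta>)" "deriv (\<lambda>x. integral {0..x} \<theta>) = \<theta>"
      using test_fun_primitive[OF flat(3) supp _ _ _ int0] by blast+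
    have "(LINT x|I01. w x * of_real (\<theta> x)) = 0"
      using weak[unfolded has_weak_deriv_def, rule_format, OF prim(1)] by (simp only: prim(2)) simp
    then have "(LINT x|I01. w x * of_real (\<psi> x)) = c * m \<psi>"
      using split[OF w] r by (simp add: c_def)
    moreover have "(LINT x|I01. g x * of_real (\<psi> x)) = (LINT x|I01. w x * of_real (\<psi> x)) - c * m \<psi>"
      unfolding g_def left_diff_distrib m_def
      using L2_mult_integrable[OF w L2(1)] L2_integrable[OF L2(1)] by simp
    ultimately show ?thesis by (simp add: \<psi>_def)
  qed
  have int0: "integral {a..b} g = 0" if "0 < a" "a < b" "b < 1" for a b
    using LINT_plateau_tendsto[OF g that] zero[OF that] by (simp add: LIMSEQ_const_iff)
  define G where "G = (\<lambda>x. integral {0..x} g)"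
  have G_cont: "continuous_on {0..1} G" unfolding G_def by (rule L2_primitive_continuous[OF g])
  have step: "G a = G b" if "0 < a" "a < b" "b < 1" for a b
    using int0[OF that] that integrable_on_subinterval[OF L2_integrable_on[OF g], of 0 b]
      Henstock_Kurzweil_Integration.integral_combine[of 0 a b g]
    by (simp add: G_def)
  have interior: "G x = G (1/2)" if "x \<in> {0<..<1}" for x
  proof (cases x "1/2::real" rule: linorder_cases)
    case less
    then show ?thesis using step[of x "1/2"] that by simp
  next
    case greater
    then show ?thesis using step[of "1/2" x] that by simp
  next
    case equal
    then show ?thesis by (rule arg_cong)
  qed
  have cl: "closure {0<..<1} = {0..1::real}" by simp
  have const: "G x = G (1/2)" if "x \<in> {0..1}" for x
    by (rule continuous_constant_on_closure[OF G_cont[folded cl] interior that[folded cl]])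
  have "G x = 0" if "x \<in> {0..1}" for x
  proof -
    have "G 0 = 0" by (simp add: G_def)
    with const[OF that] const[of 0] show ?thesis by simp
  qed
  then have "AE x in I01. g x = 0"
    by (intro L2_primitive_zero g) (simp add: G_def)
  then have "AE x in I01. w x = c" by (simp add: g_def)
  then show ?thesis by blast
qed

lemma test_funD:
  assumes "test_fun \<phi>"
  shows "\<phi> 0 = 0" "\<phi> 1 = 0" "continuous_on S (deriv \<phi>)"
    "(\<phi> has_field_derivative deriv \<phi> x) (at x)" "continuous_on S \<phi>"
proof -
  have "x \<in> {0<..<1}" if "\<phi> x \<noteq> 0" for x
    using assms closure_subset[of "{x. \<phi> x \<noteq> 0}"] that unfolding test_fun_def by blast
  from this[of 0] this[of 1] show "\<phi> 0 = 0" "\<phi> 1 = 0" by auto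
  have d: "(deriv ^^ n) \<phi> field_differentiable at x" for n x
    using assms unfolding test_fun_def by blast
  show "continuous_on S (deriv \<phi>)" "continuous_on S \<phi>"
    using d[of 1] d[of 0]
    by (auto intro!: continuous_at_imp_continuous_on field_differentiable_imp_continuous_at)
  show "(\<phi> has_field_derivative deriv \<phi> x) (at x)"
    using d[of 0 x] by (simp add: DERIV_deriv_iff_field_differentiable)
qed

lemma has_weak_deriv_primitive:
  assumes g: "g \<in> L2"
  shows "has_weak_deriv (\<lambda>x. c + integral {0..x} g) g"
  unfolding has_weak_deriv_def
proof (intro allI impI)
  fix \<phi> assume \<phi>: "test_fun \<phi>"
  have "((\<lambda>x. complex_of_real (\<phi> x)) has_vector_derivative complex_of_real (deriv \<phi> x)) (at x within {0..1})" for x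
    using test_funD(4)[OF \<phi>, of x] by (intro has_vector_derivative_of_real)
      (auto simp: has_real_derivative_iff_has_vector_derivative intro: has_vector_derivative_at_within)
  moreover have "continuous_on {0..1} (\<lambda>x. complex_of_real (deriv \<phi> x))"
    by (intro continuous_intros test_funD \<phi>)
  ultimately show "(LINT x|I01. (c + integral {0..x} g) * of_real (deriv \<phi> x)) = - (LINT x|I01. g x * of_real (\<phi> x))"
    using L2_integration_by_parts_affine[OF g, of "\<lambda>x. of_real (deriv \<phi> x)" "\<lambda>x. of_real (\<phi> x)" c]
      test_funD(1,2)[OF \<phi>] by (simp add: eq_neg_iff_add_eq_0)
qed

lemma has_weak_deriv_AE_cong:
  assumes "AE x in I01. y x = z x" "y \<in> L2" "z \<in> L2"
  shows "has_weak_deriv y g \<longleftrightarrow> has_weak_deriv z g"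
proof -
  have "(LINT x|I01. y x * of_real (deriv \<phi> x)) = (LINT x|I01. z x * of_real (deriv \<phi> x))"
    if \<phi>: "test_fun \<phi>" for \<phi>
  proof -
    have "(\<lambda>x. complex_of_real (deriv \<phi> x)) \<in> L2"
      by (intro L2_continuous continuous_intros test_funD \<phi>)
    then show ?thesis
      using assms by (intro integral_cong_AE) (auto intro!: borel_measurable_integrable L2_mult_integrable)
  qed
  then show ?thesis by (auto simp: has_weak_deriv_def)
qed

lemma has_weak_deriv_diff:
  assumes "has_weak_deriv y f" "has_weak_deriv z g" "y \<in> L2" "z \<in> L2" "f \<in> L2" "g \<in> L2"
  shows "has_weak_deriv (\<lambda>x. y x - z x) (\<lambda>x. f x - g x)"
  unfolding has_weak_deriv_def
proof (intro allI impI)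
  fix \<phi> assume \<phi>: "test_fun \<phi>"
  have "(\<lambda>x. complex_of_real (deriv \<phi> x)) \<in> L2" "(\<lambda>x. complex_of_real (\<phi> x)) \<in> L2"
    by (intro L2_continuous continuous_intros test_funD \<phi>)+
  then show "(LINT x|I01. (y x - z x) * of_real (deriv \<phi> x)) = - (LINT x|I01. (f x - g x) * of_real (\<phi> x))"
    using assms \<phi> by (simp add: left_diff_distrib L2_mult_integrable has_weak_deriv_def)
qed

text \<open>Given a weak derivative \<open>g\<close>, subtracting the primitive of \<open>g\<close>
  leaves weak derivative 0, hence a constant. The right-hand side is continuous on the closed
  interval and so makes endpoint values accessible.\<close>

theorem has_weak_deriv_iff_primitive:
  assumes y: "y \<in> L2" and g: "g \<in> L2"
  shows "has_weak_deriv y g \<longleftrightarrow> (\<exists>c. AE x in I01. y x = c + integral {0..x} g)"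
proof
  have P: "(\<lambda>x. c + integral {0..x} g) \<in> L2" for c
    by (intro L2_continuous continuous_intros L2_primitive_continuous g)
  show "has_weak_deriv y g" if "\<exists>c. AE x in I01. y x = c + integral {0..x} g"
    using that has_weak_deriv_AE_cong[OF _ y P] has_weak_deriv_primitive[OF g] by blast
  assume "has_weak_deriv y g"
  then have "has_weak_deriv (\<lambda>x. y x - (0 + integral {0..x} g)) (\<lambda>x. g x - g x)"
    by (intro has_weak_deriv_diff has_weak_deriv_primitive y g P)
  then obtain c where "AE x in I01. y x - (0 + integral {0..x} g) = c"
    using has_weak_deriv_0_imp_const[OF L2_diff[OF y P[of 0]]] by auto
  then have "AE x in I01. y x = c + integral {0..x} g"
    by eventually_elim (simp add: algebra_simps)
  then show "\<exists>c. AE x in I01. y x = c + integral {0..x} g" by blast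
qed

text \<open>A closed set containing almost every point of an open interval contains the interval and
  its closure. Applied to the set of agreement, this makes the boundary values in
  \<open>O_dom\<close> independent of the representative.\<close>

lemma continuous_AE_eq:
  fixes F G :: "real \<Rightarrow> complex"
  assumes "continuous_on {0..1} F" "continuous_on {0..1} G" "AE x in I01. F x = G x" "x \<in> {0..1}"
  shows "F x = G x"
proof -
  define C where "C = {x \<in> {0..1}. F x - G x = 0}"
  have C: "closed C"
    unfolding C_def using assms by (intro continuous_closed_preimage_constant continuous_intros) auto
  have "AE x in lebesgue. x \<in> {0<..<1} \<longrightarrow> x \<in> C"
    using assms(3) by (subst (asm) AE_restrict_space_iff) (auto simp: C_def elim!: eventually_mono)
  then have "{0<..<1} \<subseteq> C"
    using mem_closed_if_AE_lebesgue_open[OF open_greaterThanLessThan C] by blast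
  then have "closure {0<..<1} \<subseteq> C" using C by (rule closure_minimal)
  then show ?thesis using assms(4) by (auto simp: C_def)
qed

subsection \<open>The operator and the convolution\<close>

lemma cnj_v_sys: "h > 0 \<Longrightarrow> cnj (v_sys h j x) = exp (- \<i> * lambda_sys h j * of_real x)"
  by (simp add: v_sys_def lambda_sys_def powr_def exp_cnj exp_of_real[symmetric] algebra_simps
      flip: exp_add)

lemma cnj_v_sys_has_vector_derivative:
  assumes "h > 0"
  shows "((\<lambda>x. cnj (v_sys h j x)) has_vector_derivative (- \<i> * lambda_sys h j * cnj (v_sys h j x))) (at x within S)"
proof -
  define c where "c = - \<i> * lambda_sys h j"
  have "((\<lambda>z. exp (c * z)) has_field_derivative (c * exp (c * of_real x))) (at (of_real x))"
    by (auto intro!: derivative_eq_intros)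
  then have "((\<lambda>x. exp (c * of_real x)) has_vector_derivative (c * exp (c * of_real x))) (at x within S)"
    by (rule has_vector_derivative_real_field)
  then show ?thesis unfolding cnj_v_sys[OF assms] c_def .
qed

text \<open>Integration by parts against an exponential. The conjugate of \<open>v_sys h j\<close>
  is 1 at 0 and 1/h at 1 for every \<open>j\<close>, so the last summand does not depend on
  \<open>j\<close>.\<close>

lemma L2_inner_weak_deriv_v_sys:
  assumes h: "h > 0" and g: "g \<in> L2"
  shows "L2_inner g (v_sys h j) =
    \<i> * lambda_sys h j * L2_inner (\<lambda>x. c + integral {0..x} g) (v_sys h j) +
    ((c + integral {0..1} g) / of_real h - c)"
proof -
  have "continuous_on {0..1} (\<lambda>x. - \<i> * lambda_sys h j * cnj (v_sys h j x))"
    by (intro continuous_intros continuous_v_sys h)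
  note ibp = L2_integration_by_parts_affine[OF g this cnj_v_sys_has_vector_derivative[OF h], of c]
  have "(LINT x|I01. (c + integral {0..x} g) * (- \<i> * lambda_sys h j * cnj (v_sys h j x))) =
      - \<i> * lambda_sys h j * L2_inner (\<lambda>x. c + integral {0..x} g) (v_sys h j)"
    unfolding L2_inner_def by (subst integral_mult_right_zero[symmetric]) (simp add: mult_ac)
  then show ?thesis
    using ibp h unfolding L2_inner_def
    by (simp add: v_sys_eq powr_minus algebra_simps divide_inverse)
qed

text \<open>The real part is 2 pi j. The value 0 does occur, for \<open>j = 0\<close> when
  \<open>h = 1\<close>, which is why that index is treated separately below.\<close>

lemma lambda_sys_eq_0: "lambda_sys h j = 0 \<Longrightarrow> j = 0"
  by (simp add: lambda_sys_def complex_eq_iff)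

text \<open>The coefficient identity for the constant 1, whose derivative is 0, reduces a vanishing
  pairing to \<open>h = 1\<close>; but then the pairing is 1. The pairing is the divisor when the
  constant of integration is chosen.\<close>

lemma L2_inner_1_v_sys:
  assumes h: "h > 0"
  shows "L2_inner (\<lambda>x. 1) (v_sys h 0) \<noteq> 0"
proof
  assume zero: "L2_inner (\<lambda>x. 1) (v_sys h 0) = 0"
  then have "1 / complex_of_real h - 1 = 0"
    using L2_inner_weak_deriv_v_sys[OF h L2_const[of 0], of 0 1] by (simp add: L2_inner_def)
  then have "h = 1" using h by simp
  then have "L2_inner (\<lambda>x. 1) (v_sys h 0) = L2_inner (fourier_char 0) (fourier_char 0)"
    by (simp add: v_sys_eq[abs_def] L2_inner_def)
  then show False using zero fourier_char_orthonormal[of 0 0] by simp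
qed

lemma assoc_series_O_dom:
  assumes h: "h > 0" and f: "f \<in> O_dom h" and g: "g \<in> L2" "has_weak_deriv f g"
  shows "L2_has_sum (assoc_series (u_sys h) (v_sys h) (lambda_sys h) f) (\<lambda>x. - \<i> * g x)"
proof -
  obtain Y where Y: "continuous_on {0..1} Y" "AE x in I01. Y x = f x" "of_real h * Y 0 = Y 1"
    and f2: "f \<in> L2"
    using f by (auto simp: O_dom_def W12_def)
  obtain c where c: "AE x in I01. f x = c + integral {0..x} g"
    using has_weak_deriv_iff_primitive[OF f2 g(1)] g(2) by blast
  have P: "continuous_on {0..1} (\<lambda>x. c + integral {0..x} g)"
    by (intro continuous_intros L2_primitive_continuous g)
  \<comment> \<open>Two continuous representatives of \<open>f\<close> agree up to the endpoints, so
    the condition on \<open>Y\<close> says that the boundary term of the primitive vanishes.\<close>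
  have "AE x in I01. Y x = c + integral {0..x} g"
    using Y(2) c by eventually_elim simp
  then have "Y x = c + integral {0..x} g" if "x \<in> {0..1}" for x
    using continuous_AE_eq[OF Y(1) P] that by blast
  from this[of 0] this[of 1] have "(c + integral {0..1} g) / of_real h - c = 0"
    using Y(3) h by (simp add: field_simps)
  then have "L2_inner g (v_sys h j) = \<i> * lambda_sys h j * L2_inner f (v_sys h j)" for j
    using L2_inner_weak_deriv_v_sys[OF h g(1), of j c]
      L2_inner_AE_cong[OF c f2 L2_continuous[OF P] v_sys_L2[OF h]] by simp
  then have "L2_inner (\<lambda>x. - \<i> * g x) (v_sys h j) = lambda_sys h j * L2_inner f (v_sys h j)" for j
    unfolding L2_inner_scale_left by (simp add: mult.assoc)
  then show ?thesis
    using u_sys_expansion[OF h L2_scale[OF g(1), of "- \<i>"]]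
    unfolding assoc_series_def by simp
qed

text \<open>The sum \<open>s\<close> of the series has to be -i times the derivative, so the
  primitive of \<open>\<i> * s\<close> is, up to a constant, the candidate for the continuous
  representative of \<open>f\<close>.\<close>

lemma assoc_series_summable_imp_O_dom:
  assumes h: "h > 0" and f: "f \<in> L2"
    and s: "L2_has_sum (assoc_series (u_sys h) (v_sys h) (lambda_sys h) f) s"
  shows "f \<in> O_dom h"
proof -
  define g where "g = (\<lambda>x. \<i> * s x)"
  have s2: "s \<in> L2" using s by (simp add: L2_has_sum_def)
  have g: "g \<in> L2" unfolding g_def by (rule L2_scale[OF s2])
  have g_coeff: "L2_inner g (v_sys h j) = \<i> * lambda_sys h j * L2_inner f (v_sys h j)" for j
    using u_sys_coeff[OF h s[unfolded assoc_series_def], of j]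
    by (simp add: g_def L2_inner_scale_left)
  let ?P = "\<lambda>x. integral {0..x} g"
  have P: "?P \<in> L2" by (intro L2_continuous L2_primitive_continuous g)
  \<comment> \<open>Solved from the requirement that \<open>Y\<close> and \<open>f\<close> have the
    same coefficient at index 0.\<close>
  define c where "c = (L2_inner f (v_sys h 0) - L2_inner ?P (v_sys h 0)) / L2_inner (\<lambda>x. 1) (v_sys h 0)"
  define Y where "Y = (\<lambda>x. c + ?P x)"
  have Y_cont: "continuous_on {0..1} Y"
    unfolding Y_def by (intro continuous_intros L2_primitive_continuous g)
  then have Y: "Y \<in> L2" by (rule L2_continuous)
  have "?P = (\<lambda>x. Y x - c * 1)" by (simp add: Y_def)
  then have "L2_inner ?P (v_sys h 0) = L2_inner Y (v_sys h 0) - c * L2_inner (\<lambda>x. 1) (v_sys h 0)"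
    using L2_inner_diff_left[OF Y L2_scale[OF L2_const] v_sys_L2[OF h], of c 1 0]
    by (simp only: L2_inner_scale_left)
  then have coeff_0: "L2_inner Y (v_sys h 0) = L2_inner f (v_sys h 0)"
    using L2_inner_1_v_sys[OF h] by (simp add: c_def)
  define D where "D = (c + integral {0..1} g) / of_real h - c"
  have green: "\<i> * lambda_sys h j * L2_inner f (v_sys h j) =
      \<i> * lambda_sys h j * L2_inner Y (v_sys h j) + D" for j
    using L2_inner_weak_deriv_v_sys[OF h g, of j c] unfolding g_coeff D_def Y_def .
  \<comment> \<open>\<open>D\<close> is common to all indices, so equal coefficients at 0 give the
    boundary condition; the remaining coefficients then agree since their eigenvalues are
    nonzero.\<close>
  from green[of 0] have D: "D = 0" by (simp add: coeff_0)
  have "L2_inner f (v_sys h j) = L2_inner Y (v_sys h j)" for j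
  proof (cases "j = 0")
    case False
    then have "lambda_sys h j \<noteq> 0" using lambda_sys_eq_0 by blast
    then show ?thesis using green[of j] D by simp
  qed (simp add: coeff_0)
  then have "L2_inner (\<lambda>x. f x - Y x) (v_sys h j) = 0" for j
    using L2_inner_diff_left[OF f Y v_sys_L2[OF h]] by simp
  then have fY: "AE x in I01. f x = Y x"
    using v_sys_complete[OF h L2_diff[OF f Y]] by simp
  then have "has_weak_deriv f g"
    using has_weak_deriv_iff_primitive[OF f g] unfolding Y_def by blast
  then have "f \<in> W12" using f g by (auto simp: W12_def)
  moreover have "AE x in I01. Y x = f x" using fY by eventually_elim simp
  moreover have "of_real h * Y 0 = Y 1"
    using D h by (simp add: D_def Y_def field_simps)
  ultimately show ?thesis using Y_cont by (auto simp: O_dom_def)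
qed

section \<open>The convolution integral\<close>

lemma L2_affine_restrict:
  fixes \<sigma> c a b :: real
  assumes f: "f \<in> L2" and \<sigma>: "\<bar>\<sigma>\<bar> = 1"
    and sub: "\<And>t. t \<in> {a<..<b} \<Longrightarrow> c + \<sigma> * t \<in> {0<..<1}"
  shows "(\<lambda>t. f (c + \<sigma> * t)) \<in> borel_measurable (lebesgue_on {a<..<b})"
    "integrable (lebesgue_on {a<..<b}) (\<lambda>t. (cmod (f (c + \<sigma> * t)))\<^sup>2)"
    "sqrt (LINT t|lebesgue_on {a<..<b}. (cmod (f (c + \<sigma> * t)))\<^sup>2) \<le> L2_norm f"
proof -
  have \<sigma>0: "\<sigma> \<noteq> 0" using \<sigma> by auto
  \<comment> \<open>Extension by zero, so that the change of variables can be made on the whole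
    line.\<close>
  define F where "F = (\<lambda>x. indicator {0<..<1::real} x *\<^sub>R f x)"
  have F_eq: "F (c + \<sigma> * t) = f (c + \<sigma> * t)" if "t \<in> {a<..<b}" for t
    using sub[OF that] by (simp add: F_def)
  have F: "F \<in> borel_measurable lebesgue"
    using L2_measurable[OF f] unfolding F_def by (simp add: borel_measurable_restrict_space_iff)
  have sq: "(\<lambda>x. (cmod (F x))\<^sup>2) = (\<lambda>x. indicator {0<..<1} x *\<^sub>R (cmod (f x))\<^sup>2)"
    by (auto simp: F_def indicator_def)
  have int: "integrable lebesgue (\<lambda>x. (cmod (F x))\<^sup>2)"
    using L2_sq_integrable[OF f] unfolding sq by (simp add: integrable_restrict_space)
  then have int': "integrable lebesgue (\<lambda>t. (cmod (F (c + \<sigma> * t)))\<^sup>2)"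
    by (rule lebesgue_integrable_real_affine[OF _ \<sigma>0])
  have "(\<lambda>t. c + \<sigma> * t) \<in> lebesgue \<rightarrow>\<^sub>M lebesgue"
    using lebesgue_affine_measurable[where c="\<lambda>x::real. \<sigma>"] \<sigma>0 by simp
  then have "(\<lambda>t. F (c + \<sigma> * t)) \<in> borel_measurable lebesgue"
    using F by (rule measurable_compose)
  then have "(\<lambda>t. F (c + \<sigma> * t)) \<in> borel_measurable (lebesgue_on {a<..<b})"
    by (rule measurable_restrict_space1)
  then show "(\<lambda>t. f (c + \<sigma> * t)) \<in> borel_measurable (lebesgue_on {a<..<b})"
    by (subst measurable_cong[of _ _ "\<lambda>t. F (c + \<sigma> * t)"]) (simp_all add: F_eq)
  have "integrable (lebesgue_on {a<..<b}) (\<lambda>t. (cmod (F (c + \<sigma> * t)))\<^sup>2)"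
    using integrable_mult_indicator[OF _ int', of "{a<..<b}"] by (simp add: integrable_restrict_space)
  then show "integrable (lebesgue_on {a<..<b}) (\<lambda>t. (cmod (f (c + \<sigma> * t)))\<^sup>2)"
    by (subst Bochner_Integration.integrable_cong[of _ _ _ "\<lambda>t. (cmod (F (c + \<sigma> * t)))\<^sup>2"]) (simp_all add: F_eq)
  have "(LINT t|lebesgue_on {a<..<b}. (cmod (f (c + \<sigma> * t)))\<^sup>2) =
      (LINT t|lebesgue. indicator {a<..<b} t *\<^sub>R (cmod (F (c + \<sigma> * t)))\<^sup>2)"
    by (subst integral_restrict_space) (auto intro!: Bochner_Integration.integral_cong simp: indicator_def F_eq)
  also have "\<dots> \<le> (LINT t|lebesgue. (cmod (F (c + \<sigma> * t)))\<^sup>2)"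
    by (rule integral_mono'[OF int']) (auto simp: indicator_def)
  \<comment> \<open>The substitution has Jacobian 1 because the modulus of \<open>\<sigma>\<close>
    is 1.\<close>
  also have "\<dots> = (LINT x|lebesgue. (cmod (F x))\<^sup>2)"
    using lebesgue_integral_real_affine[OF \<sigma>0, of "\<lambda>x. (cmod (F x))\<^sup>2" c] \<sigma> by simp
  also have "\<dots> = (LINT x|I01. (cmod (f x))\<^sup>2)"
    unfolding sq by (subst integral_restrict_space) auto
  finally show "sqrt (LINT t|lebesgue_on {a<..<b}. (cmod (f (c + \<sigma> * t)))\<^sup>2) \<le> L2_norm f"
    unfolding L2_norm_def by simp
qed

text \<open>A reflected and translated piece of \<open>f\<close> has norm at most that of
  \<open>f\<close>, so Cauchy-Schwarz applies for each single \<open>c\<close>. The values used are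
  \<open>c = x\<close> on (0, x) and \<open>c = 1 + x\<close> on (x, 1).\<close>

lemma conv_piece:
  assumes f: "f \<in> L2" and g: "g \<in> L2"
    and sub: "\<And>t. t \<in> {a<..<b} \<Longrightarrow> t \<in> {0<..<1} \<and> c - t \<in> {0<..<1}"
  shows "integrable (lebesgue_on {a<..<b}) (\<lambda>t. f (c - t) * g t)"
    "cmod (LINT t|lebesgue_on {a<..<b}. f (c - t) * g t) \<le> L2_norm f * L2_norm g"
proof -
  have "c + -1 * t \<in> {0<..<1}" "0 + 1 * t \<in> {0<..<1}" if "t \<in> {a<..<b}" for t
    using sub[OF that] by auto
  note F = L2_affine_restrict[OF f _ this(1)] and G = L2_affine_restrict[OF g _ this(2)]
  show "integrable (lebesgue_on {a<..<b}) (\<lambda>t. f (c - t) * g t)"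
    using integrable_mult_sq[OF F(1,2) G(1,2)] by simp
  have "cmod (LINT t|lebesgue_on {a<..<b}. f (c - t) * g t) \<le>
      sqrt (LINT t|lebesgue_on {a<..<b}. (cmod (f (c - t)))\<^sup>2) * sqrt (LINT t|lebesgue_on {a<..<b}. (cmod (g t))\<^sup>2)"
    using Cauchy_Schwarz_integral[OF F(1,2) G(1,2)] by simp
  also have "\<dots> \<le> L2_norm f * L2_norm g"
    using F(3) G(3) by (intro mult_mono) auto
  finally show "cmod (LINT t|lebesgue_on {a<..<b}. f (c - t) * g t) \<le> L2_norm f * L2_norm g" .
qed

definition U_conv_integral :: "real \<Rightarrow> (real \<Rightarrow> complex) \<Rightarrow> (real \<Rightarrow> complex) \<Rightarrow> real \<Rightarrow> complex" where
  "U_conv_integral h f g x = (LINT t|lebesgue_on {0<..<x}. f (x - t) * g t) +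
     1 / of_real h * (LINT t|lebesgue_on {x<..<1}. f (1 + x - t) * g t)"

lemma conv_integrable:
  assumes "f \<in> L2" "g \<in> L2" "x \<in> {0<..<1}"
  shows "integrable (lebesgue_on {0<..<x}) (\<lambda>t. f (x - t) * g t)"
    "integrable (lebesgue_on {x<..<1}) (\<lambda>t. f (1 + x - t) * g t)"
  using assms by (auto intro!: conv_piece(1))

lemma U_conv_integral_bound:
  assumes h: "h > 0" and f: "f \<in> L2" and g: "g \<in> L2" and x: "x \<in> {0<..<1}"
  shows "cmod (U_conv_integral h f g x) \<le> (1 + 1 / h) * (L2_norm f * L2_norm g)"
proof -
  have "cmod (U_conv_integral h f g x) \<le> cmod (LINT t|lebesgue_on {0<..<x}. f (x - t) * g t) +
      1 / h * cmod (LINT t|lebesgue_on {x<..<1}. f (1 + x - t) * g t)"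
    unfolding U_conv_integral_def using h
    by (intro order_trans[OF norm_triangle_ineq]) (simp add: norm_mult norm_divide)
  also have "\<dots> \<le> L2_norm f * L2_norm g + 1 / h * (L2_norm f * L2_norm g)"
    using x h by (intro add_mono mult_left_mono conv_piece(2) f g) auto
  finally show ?thesis by (simp add: algebra_simps)
qed

lemma U_conv_integral_diff_left:
  assumes "f \<in> L2" "k \<in> L2" "g \<in> L2" "x \<in> {0<..<1}"
  shows "U_conv_integral h (\<lambda>x. f x - k x) g x = U_conv_integral h f g x - U_conv_integral h k g x"
  unfolding U_conv_integral_def left_diff_distrib
    Bochner_Integration.integral_diff[OF conv_integrable(1)[OF assms(1,3,4)] conv_integrable(1)[OF assms(2,3,4)]]
    Bochner_Integration.integral_diff[OF conv_integrable(2)[OF assms(1,3,4)] conv_integrable(2)[OF assms(2,3,4)]]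
  by (simp add: right_diff_distrib)

lemma U_conv_integral_sum_left:
  assumes "\<And>j. j \<in> G \<Longrightarrow> w j \<in> L2" "g \<in> L2" "x \<in> {0<..<1}"
  shows "U_conv_integral h (\<lambda>x. \<Sum>j\<in>G. a j * w j x) g x = (\<Sum>j\<in>G. a j * U_conv_integral h (w j) g x)"
proof -
  have "(LINT t|lebesgue_on {0<..<x}. (\<Sum>j\<in>G. a j * w j (x - t)) * g t) =
      (\<Sum>j\<in>G. a j * (LINT t|lebesgue_on {0<..<x}. w j (x - t) * g t))"
    unfolding sum_distrib_right mult.assoc using assms
    by (subst Bochner_Integration.integral_sum) (auto intro!: integrable_mult_right conv_integrable)
  moreover have "(LINT t|lebesgue_on {x<..<1}. (\<Sum>j\<in>G. a j * w j (1 + x - t)) * g t) =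
      (\<Sum>j\<in>G. a j * (LINT t|lebesgue_on {x<..<1}. w j (1 + x - t) * g t))"
    unfolding sum_distrib_right mult.assoc using assms
    by (subst Bochner_Integration.integral_sum) (auto intro!: integrable_mult_right conv_integrable)
  ultimately show ?thesis
    unfolding U_conv_integral_def
    by (simp add: sum_distrib_left sum.distrib[symmetric] distrib_left mult.left_commute)
qed

text \<open>The kernel \<open>u\<^sub>j(x - t)\<close> splits as \<open>u\<^sub>j(x)\<close> times the conjugate of \<open>v\<^sub>j(t)\<close>, and the factor \<open>1/h\<close>
  compensates for \<open>u\<^sub>j(1 + y) = h u\<^sub>j(y)\<close>.\<close>

lemma U_conv_integral_u_sys:
  assumes h: "h > 0" and g: "g \<in> L2" and x: "x \<in> {0<..<1}"
  shows "U_conv_integral h (u_sys h j) g x = L2_inner g (v_sys h j) * u_sys h j x"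
proof -
  let ?w = "\<lambda>t. g t * cnj (v_sys h j t)"
  have shift: "u_sys h j (x - t) = u_sys h j x * cnj (v_sys h j t)" for t
    using h fourier_char_plus[of j x "- t"]
    by (simp add: u_sys_eq v_sys_eq powr_diff powr_minus divide_inverse cnj_fourier_char)
      (simp add: fourier_char_def)
  have period: "u_sys h j (1 + y) = of_real h * u_sys h j y" for y
    using h by (simp add: u_sys_eq powr_add fourier_char_plus)
  have "integrable (lebesgue_on {0<..<x}) (\<lambda>t. u_sys h j (x - t) * g t)"
    "integrable (lebesgue_on {x<..<1}) (\<lambda>t. u_sys h j (1 + x - t) * g t)"
    by (intro conv_integrable u_sys_L2 h g x)+
  from this[THEN lebesgue_integral_eq_integral] have "U_conv_integral h (u_sys h j) g x =
      integral {0<..<x} (\<lambda>t. u_sys h j (x - t) * g t) +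
      1 / of_real h * integral {x<..<1} (\<lambda>t. u_sys h j (1 + x - t) * g t)"
    by (simp add: U_conv_integral_def)
  also have "(\<lambda>t. u_sys h j (x - t) * g t) = (\<lambda>t. u_sys h j x * ?w t)"
    by (simp add: shift mult_ac)
  also have "(\<lambda>t. u_sys h j (1 + x - t) * g t) = (\<lambda>t. of_real h * (u_sys h j x * ?w t))"
    unfolding add_diff_eq[symmetric] period by (simp add: shift mult_ac)
  also have "integral {0<..<x} (\<lambda>t. u_sys h j x * ?w t) + 1 / of_real h * integral {x<..<1} \<dots> =
      u_sys h j x * (integral {0..x} ?w + integral {x..1} ?w)"
    using h by (simp add: integral_open_interval_real distrib_left)
  also have "integral {0..x} ?w + integral {x..1} ?w = integral {0..1} ?w"
  proof (rule Henstock_Kurzweil_Integration.integral_combine)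
    show "?w integrable_on {0..1}"
      using integrable_on_lebesgue_on[OF L2_mult_integrable[OF g L2_cnj[OF v_sys_L2[OF h]]]]
      by (simp add: integrable_on_open_interval_real)
  qed (use x in auto)
  also have "\<dots> = L2_inner g (v_sys h j)"
    unfolding L2_inner_def
    using lebesgue_integral_eq_integral[OF L2_mult_integrable[OF g L2_cnj[OF v_sys_L2[OF h]]]]
    by (simp add: integral_open_interval_real)
  finally show ?thesis by (simp add: mult.commute)
qed

lemma conv_series_has_sum:
  assumes h: "h > 0" and f: "f \<in> L2" and g: "g \<in> L2"
  shows "L2_has_sum (conv_series (u_sys h) (v_sys h) f g) (U_conv_integral h f g)"
proof -
  define S where "S = (\<lambda>F x. \<Sum>j\<in>F. conv_series (u_sys h) (v_sys h) f g j x)"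
  define p where "p = (\<lambda>F x. \<Sum>j\<in>F. L2_inner f (v_sys h j) * u_sys h j x)"
  define C where "C = (1 + 1 / h) * L2_norm g"
  have "C \<ge> 0" using h by (simp add: C_def)
  have p: "p F \<in> L2" for F
    unfolding p_def by (intro L2_sum_fun L2_scale u_sys_L2 h)
  have S: "S F \<in> L2" for F
    unfolding S_def conv_series_def by (intro L2_sum_fun L2_scale u_sys_L2 h)
  have S_eq: "S F x = U_conv_integral h (p F) g x" if "x \<in> {0<..<1}" for F x
    unfolding p_def S_def conv_series_def
    using that by (simp add: U_conv_integral_sum_left[OF u_sys_L2[OF h] g] U_conv_integral_u_sys[OF h g] mult.assoc)
  have diff: "cmod (S F x - U_conv_integral h f g x) \<le> C * L2_norm (\<lambda>x. p F x - f x)"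
    if "x \<in> {0<..<1}" for F x
    using U_conv_integral_bound[OF h L2_diff[OF p f] g that] that
    by (simp add: S_eq U_conv_integral_diff_left[OF p f g] C_def mult_ac)
  have lim: "((\<lambda>F. C * L2_norm (\<lambda>x. p F x - f x)) \<longlongrightarrow> 0) (finite_subsets_at_top UNIV)"
    using u_sys_expansion[OF h f] unfolding L2_has_sum_def p_def by (auto intro: tendsto_mult_right_zero)
  \<comment> \<open>Measurability passes to limits of sequences, so a sequence of index sets with
    errors below 1/(n+1) is extracted from the net.\<close>
  have "\<exists>F. C * L2_norm (\<lambda>x. p F x - f x) < inverse (real (Suc n))" for n
    using eventually_happens[OF order_tendstoD(2)[OF lim, of "inverse (real (Suc n))"]] by auto
  then obtain F where F: "\<And>n. C * L2_norm (\<lambda>x. p (F n) x - f x) < inverse (real (Suc n))" by metis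
  have "U_conv_integral h f g \<in> borel_measurable I01"
  proof (rule borel_measurable_LIMSEQ_metric)
    show "S (F n) \<in> borel_measurable I01" for n by (rule L2_measurable[OF S])
    fix x assume "x \<in> space I01"
    then have x: "x \<in> {0<..<1}" by simp
    have "cmod (S (F n) x - U_conv_integral h f g x) \<le> inverse (real (Suc n))" for n
      using diff[OF x, of "F n"] F[of n] by simp
    then have "(\<lambda>n. S (F n) x - U_conv_integral h f g x) \<longlonglongrightarrow> 0"
      by (intro Lim_null_comparison[OF always_eventually LIMSEQ_inverse_real_of_nat]) blast
    then show "(\<lambda>n. S (F n) x) \<longlonglongrightarrow> U_conv_integral h f g x" by (simp add: LIM_zero_iff)
  qed
  then have K: "U_conv_integral h f g \<in> L2"
    by (rule L2_bounded(1)) (rule U_conv_integral_bound[OF h f g])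
  have "L2_norm (\<lambda>x. S F x - U_conv_integral h f g x) \<le> C * L2_norm (\<lambda>x. p F x - f x)" for F
    by (intro L2_bounded(2) L2_measurable L2_diff S K diff)
  then have "((\<lambda>F. L2_norm (\<lambda>x. S F x - U_conv_integral h f g x)) \<longlongrightarrow> 0) (finite_subsets_at_top UNIV)"
    by (intro Lim_null_comparison[OF _ lim] always_eventually) simp
  then show ?thesis
    using K unfolding L2_has_sum_def S_def by (auto simp: conv_series_def intro!: L2_scale u_sys_L2 h)
qed

theorem proposition5p1:
  fixes h :: real
  assumes "h > 0"
  shows "assoc_dom (u_sys h) (v_sys h) (lambda_sys h) = O_dom h \<and>
    (\<forall>f \<in> O_dom h. AE x in I01.
       assoc_op (u_sys h) (v_sys h) (lambda_sys h) f x = O_op f x) \<and>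
    (\<forall>f \<in> L2. \<forall>g \<in> L2.
       L2_summable (conv_series (u_sys h) (v_sys h) f g) \<and>
       (AE x in I01.
          integrable (lebesgue_on {0<..<x}) (\<lambda>t. f (x - t) * g t) \<and>
          integrable (lebesgue_on {x<..<1}) (\<lambda>t. f (1 + x - t) * g t) \<and>
          U_conv (u_sys h) (v_sys h) f g x =
            (LINT t|lebesgue_on {0<..<x}. f (x - t) * g t) +
            1 / of_real h * (LINT t|lebesgue_on {x<..<1}. f (1 + x - t) * g t)))"
proof (intro conjI ballI)
  \<comment> \<open>Membership in \<open>W12\<close> provides the witness that the choice in
    \<open>weak_deriv\<close> relies on. Any admissible choice would do, since the series is shown
    to sum to -i times each weak derivative in \<open>L2\<close>.\<close>
  have weak: "f \<in> L2 \<and> weak_deriv f \<in> L2 \<and> has_weak_deriv f (weak_deriv f)" if "f \<in> O_dom h" for f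
  proof -
    from that have "f \<in> L2" "\<exists>g. g \<in> L2 \<and> has_weak_deriv f g" by (auto simp: O_dom_def W12_def)
    from this(1) someI_ex[OF this(2)] show ?thesis unfolding weak_deriv_def by blast
  qed
  have sum: "L2_has_sum (assoc_series (u_sys h) (v_sys h) (lambda_sys h) f) (O_op f)" if "f \<in> O_dom h" for f
    unfolding O_op_def using weak[OF that] by (intro assoc_series_O_dom[OF assms that]) auto
  show "assoc_dom (u_sys h) (v_sys h) (lambda_sys h) = O_dom h"
    using weak sum assoc_series_summable_imp_O_dom[OF assms]
    unfolding assoc_dom_def L2_summable_def by blast
  show "AE x in I01. assoc_op (u_sys h) (v_sys h) (lambda_sys h) f x = O_op f x" if "f \<in> O_dom h" for f
    unfolding assoc_op_def by (rule L2_sum_AE_eq[OF sum[OF that]])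
next
  fix f g assume f: "f \<in> L2" and g: "g \<in> L2"
  note conv = conv_series_has_sum[OF assms f g]
  show "L2_summable (conv_series (u_sys h) (v_sys h) f g)"
    unfolding L2_summable_def using conv by blast
  \<comment> \<open>Integrability holds at every interior point; only the identification with the
    chosen sum \<open>U_conv\<close> is up to a null set.\<close>
  have "AE x in I01. x \<in> {0<..<1}" by (rule AE_I2) simp
  with L2_sum_AE_eq[OF conv] show "AE x in I01.
      integrable (lebesgue_on {0<..<x}) (\<lambda>t. f (x - t) * g t) \<and>
      integrable (lebesgue_on {x<..<1}) (\<lambda>t. f (1 + x - t) * g t) \<and>
      U_conv (u_sys h) (v_sys h) f g x =
        (LINT t|lebesgue_on {0<..<x}. f (x - t) * g t) +
        1 / of_real h * (LINT t|lebesgue_on {x<..<1}. f (1 + x - t) * g t)"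
    by eventually_elim (simp add: conv_integrable[OF f g] U_conv_def U_conv_integral_def)
qed

end
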